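(* For a regular one-parameter model $p(x;\theta)$ of probability densities on $\mathbb{R}^d$, a non-constant scalar estimator $a(x)$ attains the Wasserstein--Cramer--Rao lower bound for every $\theta$, i.e. $$\mathrm{Var}^{\mathrm W}_{\theta}(a(x)) = \frac{1}{G_W(\theta)}\left(\frac{\partial}{\partial\theta}\mathrm{E}_\theta[a(x)]\right)^2\qquad\text{for every }\theta,$$ if and only if the model corresponds to an e-geodesic with respect to the Otto metric (up to monotone reparametrization) and $a(x)$ is an affine function of its Wasserstein score function.
   Context: $\mathrm{E}_\theta$ denotes expectation when $x$ has density $p(\cdot;\theta)$ on $\mathbb{R}^d$; $\nabla_x$ is the gradient and $\nabla_x\cdot$ the divergence in $x$; $\theta$ is a real parameter. "Regular" is used without a specified list of conditions. Wasserstein score function: $\Phi(x;\theta)$ is the solution of the continuity equation $\frac{\partial}{\partial\theta}p(x;\theta)+\nabla_x\cdot\big(p(x;\theta)\nabla_x\Phi(x;\theta)\big)=0$ satisfying $\mathrm{E}_\theta[\Phi(x;\theta)]=0$. Wasserstein information: $G_W(\theta)=\mathrm{E}_\theta\big[\|\nabla_x\Phi(x;\theta)\|^2\big]$. Wasserstein variance of a scalar statistic: $\mathrm{Var}^{\mathrm W}_\theta(a(x))=\mathrm{E}_\theta\big[\|\nabla_x a(x)\|^2\big]$. The Otto metric is the Riemannian metric on the Wasserstein space of probability densities, and the e-connection is the dual of the m-connection with respect to it. The e-geodesics with respect to the Otto metric are characterized as the one-parameter models whose Wasserstein score function is fixed up to an additive constant: $\Phi(x;\theta)=T(x)-c(\theta)$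 for some function $T$ of $x$ only and some function $c$ of $\theta$ only. "Up to monotone reparametrization" means that the model is an e-geodesic when expressed in a parameter $\widetilde\theta=h(\theta)$ with $h$ monotone; the Wasserstein score function in the parameter $\widetilde\theta$ is defined by the same continuity equation and normalization with $\theta$ replaced by $\widetilde\theta$. *)

theory Defs
  imports "HOL-Probability.Probability"
begin

definition grad :: "('a::euclidean_space \<Rightarrow> real) \<Rightarrow> 'a \<Rightarrow> 'a" where
  "grad f x = (THE D. GDERIV f x :> D)"

definition divergence :: "('a::euclidean_space \<Rightarrow> 'a) \<Rightarrow> 'a \<Rightarrow> real" where
  "divergence F x = (\<Sum>b\<in>Basis. frechet_derivative F (at x) b \<bullet> b)"

definition C1 :: "('a::euclidean_space \<Rightarrow> 'b::real_normed_vector) \<Rightarrow> bool" where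
  "C1 f \<longleftrightarrow> (\<forall>x. f differentiable at x) \<and>
     (\<forall>v. continuous_on UNIV (\<lambda>x. frechet_derivative f (at x) v))"

text \<open>
  Parametric families are written with the parameter first: \<open>p \<theta> x\<close> is
  $p(x;\theta)$.
\<close>

definition law :: "(real \<Rightarrow> 'a::euclidean_space \<Rightarrow> real) \<Rightarrow> real \<Rightarrow> 'a measure" where
  "law p \<theta> = density lborel (\<lambda>x. ennreal (p \<theta> x))"

definition expect :: "(real \<Rightarrow> 'a::euclidean_space \<Rightarrow> real) \<Rightarrow> real \<Rightarrow> ('a \<Rightarrow> real) \<Rightarrow> real" where
  "expect p \<theta> f = integral\<^sup>L (law p \<theta>) f"

definition density_model :: "real set \<Rightarrow> (real \<Rightarrow> 'a::euclidean_space \<Rightarrow> real) \<Rightarrow> bool" where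
  "density_model \<Theta> p \<longleftrightarrow>
     open \<Theta> \<and> is_interval \<Theta> \<and> \<Theta> \<noteq> {} \<and>
     (\<forall>\<theta>\<in>\<Theta>. (\<forall>x. 0 < p \<theta> x) \<and> C1 (p \<theta>) \<and> prob_space (law p \<theta>)) \<and>
     (\<forall>x. (\<lambda>\<theta>. p \<theta> x) differentiable_on \<Theta>)"

text \<open>
  The score is required to be twice continuously differentiable in \<open>x\<close>, so that the
  continuity equation holds in the classical sense.  Among such functions with
  square-integrable gradient, the continuity equation and the normalization determine it
  uniquely when the density is positive.
\<close>

definition wasserstein_score ::
  "real set \<Rightarrow> (real \<Rightarrow> 'a::euclidean_space \<Rightarrow> real) \<Rightarrow> (real \<Rightarrow> 'a \<Rightarrow> real) \<Rightarrow> bool" where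
  "wasserstein_score \<Theta> p \<Phi> \<longleftrightarrow>
     (\<forall>\<theta>\<in>\<Theta>.
        (\<forall>x. \<Phi> \<theta> differentiable at x) \<and> C1 (grad (\<Phi> \<theta>)) \<and>
        (\<forall>x. deriv (\<lambda>t. p t x) \<theta> + divergence (\<lambda>y. p \<theta> y *\<^sub>R grad (\<Phi> \<theta>) y) x = 0) \<and>
        integrable (law p \<theta>) (\<Phi> \<theta>) \<and> expect p \<theta> (\<Phi> \<theta>) = 0)"

definition wasserstein_information ::
  "(real \<Rightarrow> 'a::euclidean_space \<Rightarrow> real) \<Rightarrow> (real \<Rightarrow> 'a \<Rightarrow> real) \<Rightarrow> real \<Rightarrow> real" where
  "wasserstein_information p \<Phi> \<theta> = expect p \<theta> (\<lambda>x. (norm (grad (\<Phi> \<theta>) x))\<^sup>2)"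

definition wasserstein_variance ::
  "(real \<Rightarrow> 'a::euclidean_space \<Rightarrow> real) \<Rightarrow> real \<Rightarrow> ('a \<Rightarrow> real) \<Rightarrow> real" where
  "wasserstein_variance p \<theta> a = expect p \<theta> (\<lambda>x. (norm (grad a x))\<^sup>2)"

definition regular_model ::
  "real set \<Rightarrow> (real \<Rightarrow> 'a::euclidean_space \<Rightarrow> real) \<Rightarrow> (real \<Rightarrow> 'a \<Rightarrow> real) \<Rightarrow> bool" where
  "regular_model \<Theta> p \<Phi> \<longleftrightarrow>
     density_model \<Theta> p \<and> wasserstein_score \<Theta> p \<Phi> \<and>
     (\<forall>\<theta>\<in>\<Theta>. integrable (law p \<theta>) (\<lambda>x. (norm (grad (\<Phi> \<theta>) x))\<^sup>2) \<and>
             0 < wasserstein_information p \<Phi> \<theta>) \<and>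
     (\<forall>x. continuous_on \<Theta> (\<lambda>\<theta>. \<Phi> \<theta> x))"

text \<open>
  The last condition is the usual local domination that permits differentiating
  $\mathrm{E}_\theta[a(x)]$ under the integral sign.
\<close>

definition regular_estimator ::
  "real set \<Rightarrow> (real \<Rightarrow> 'a::euclidean_space \<Rightarrow> real) \<Rightarrow> ('a \<Rightarrow> real) \<Rightarrow> bool" where
  "regular_estimator \<Theta> p a \<longleftrightarrow>
     C1 a \<and>
     (\<forall>\<theta>\<in>\<Theta>. integrable (law p \<theta>) a \<and> integrable (law p \<theta>) (\<lambda>x. (norm (grad a x))\<^sup>2)) \<and>
     (\<forall>\<theta>\<^sub>0\<in>\<Theta>. \<exists>\<epsilon>>0. \<exists>g. integrable lborel g \<and>
        (\<forall>\<theta>\<in>\<Theta>. \<bar>\<theta> - \<theta>\<^sub>0\<bar> < \<epsilon> \<longrightarrow> (\<forall>x. \<bar>a x * deriv (\<lambda>t. p t x) \<theta>\<bar> \<le> g x)))"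

definition attains_WCR_bound ::
  "real set \<Rightarrow> (real \<Rightarrow> 'a::euclidean_space \<Rightarrow> real) \<Rightarrow> (real \<Rightarrow> 'a \<Rightarrow> real) \<Rightarrow> ('a \<Rightarrow> real) \<Rightarrow> bool"
  where
  "attains_WCR_bound \<Theta> p \<Phi> a \<longleftrightarrow>
     (\<forall>\<theta>\<in>\<Theta>. wasserstein_variance p \<theta> a =
        1 / wasserstein_information p \<Phi> \<theta> * (deriv (\<lambda>t. expect p t a) \<theta>)\<^sup>2)"

text \<open>\<open>e_geodesic \<Theta> q \<Psi>\<close>: the model \<open>q\<close>, with score \<open>\<Psi>\<close>, is an e-geodesic for the Otto metric.\<close>

definition e_geodesic ::
  "real set \<Rightarrow> (real \<Rightarrow> 'a::euclidean_space \<Rightarrow> real) \<Rightarrow> (real \<Rightarrow> 'a \<Rightarrow> real) \<Rightarrow> bool" where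
  "e_geodesic \<Theta> q \<Psi> \<longleftrightarrow>
     regular_model \<Theta> q \<Psi> \<and> (\<exists>T c. \<forall>\<theta>\<in>\<Theta>. \<forall>x. \<Psi> \<theta> x = T x - c \<theta>)"

definition reparametrize ::
  "real set \<Rightarrow> (real \<Rightarrow> real) \<Rightarrow> (real \<Rightarrow> 'a \<Rightarrow> real) \<Rightarrow> real \<Rightarrow> 'a \<Rightarrow> real" where
  "reparametrize \<Theta> h p = (\<lambda>t. p (inv_into \<Theta> h t))"

text \<open>
  The additive term of an affine function of the score has to depend on the parameter: it
  equals $\mathrm{E}_\theta[a(x)]$, since the score has mean zero.  The slope does not.
\<close>

definition affine_in_score ::
  "real set \<Rightarrow> (real \<Rightarrow> 'a \<Rightarrow> real) \<Rightarrow> ('a \<Rightarrow> real) \<Rightarrow> bool" where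
  "affine_in_score \<Theta> \<Psi> a \<longleftrightarrow>
     (\<exists>\<alpha>::real. \<exists>\<beta>::real \<Rightarrow> real. \<forall>\<theta>\<in>\<Theta>. \<forall>x. a x = \<alpha> * \<Psi> \<theta> x + \<beta> \<theta>)"

end

theory Submission
  imports Defs
begin

text \<open>
  Differentiating under the integral sign and integrating the continuity equation by parts gives
  \<open>d/d\<theta> E\<^sub>\<theta>[a] = E\<^sub>\<theta>[\<nabla>a \<bullet> \<nabla>\<Phi>]\<close>, so the bound is the Cauchy--Schwarz inequality in \<open>L\<^sup>2(p)\<close>
  and is attained at \<open>\<theta>\<close> iff \<open>\<nabla>a\<close> is a multiple of \<open>\<nabla>\<Phi>\<close>.  If this holds for every \<open>\<theta>\<close>, write
  \<open>\<nabla>\<Phi> = \<kappa>(\<theta>) \<nabla>a\<close>; then \<open>\<kappa>\<close> is continuous and never zero, and in a parameter \<open>h(\<theta>)\<close> with \<open>h' = \<kappa>\<close> the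
  score is \<open>a - E[a]\<close>.  Conversely, \<open>\<partial>p/\<partial>\<theta>\<close> does not vanish identically because the information is
  positive, which makes the inverse of a monotone reparametrization differentiable; the two scores then
  have proportional gradients because the continuity equation determines the gradient of its potential.
  No decay of \<open>p\<close> at infinity is needed for the integration by parts: the integrability assumptions
  suffice after truncating \<open>a\<close> and multiplying by cutoff functions.
\<close>

section \<open>Calculus of gradients, \<open>C1\<close> maps and divergences\<close>

text \<open>\<open>grad\<close> is a definite description, so it is meaningful only once the
  derivative is represented as an inner product. The representing vector is assembled over
  \<open>Basis\<close>, and it is unique because inner products with all vectors separate
  points.\<close>

lemma gderiv_grad:
  fixes f :: "'a::euclidean_space \<Rightarrow> real"
  assumes "f differentiable at x"
  shows "GDERIV f x :> grad f x"
proof -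
  obtain f' where f': "(f has_derivative f') (at x)"
    using assms by (auto simp: differentiable_def)
  have lin: "linear f'"
    using f' by (rule has_derivative_linear)
  have "f' h = h \<bullet> (\<Sum>b\<in>Basis. f' b *\<^sub>R b)" for h
    using Linear_Algebra.linear_componentwise[OF lin, of h 1] by (simp add: inner_sum_right mult.commute)
  then have "f' = (\<lambda>h. h \<bullet> (\<Sum>b\<in>Basis. f' b *\<^sub>R b))"
    by blast
  then have ex: "GDERIV f x :> (\<Sum>b\<in>Basis. f' b *\<^sub>R b)"
    using f' unfolding gderiv_def by metis
  have uniq: "D = D'" if "GDERIV f x :> D" "GDERIV f x :> D'" for D D'
    using has_derivative_unique[OF that[unfolded gderiv_def]]
    by (auto simp: fun_eq_iff vector_eq_ldot)
  show ?thesis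
    unfolding grad_def by (rule theI[where P = "\<lambda>D. GDERIV f x :> D", OF ex]) (rule uniq[OF _ ex])
qed

lemma grad_eqI:
  fixes f :: "'a::euclidean_space \<Rightarrow> real"
  assumes "GDERIV f x :> D"
  shows "grad f x = D"
proof -
  have "f differentiable at x"
    using assms unfolding gderiv_def differentiable_def by blast
  from has_derivative_unique[OF gderiv_grad[OF this, unfolded gderiv_def] assms[unfolded gderiv_def]]
  show ?thesis
    by (auto simp: fun_eq_iff vector_eq_ldot)
qed

lemma frechet_derivative_eq_grad:
  fixes f :: "'a::euclidean_space \<Rightarrow> real"
  assumes "f differentiable at x"
  shows "frechet_derivative f (at x) v = grad f x \<bullet> v"
  using frechet_derivative_at[OF gderiv_grad[OF assms, unfolded gderiv_def], symmetric]
  by (simp add: inner_commute)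

lemma C1_continuous_on:
  assumes "C1 f"
  shows "continuous_on S f"
  using assms unfolding C1_def
  by (meson continuous_at_imp_continuous_on differentiable_imp_continuous_within)

lemma C1_continuous_grad:
  fixes f :: "'a::euclidean_space \<Rightarrow> real"
  assumes "C1 f"
  shows "continuous_on S (grad f)"
proof -
  have "continuous_on UNIV (\<lambda>x. grad f x \<bullet> b)" for b
  proof -
    have "(\<lambda>x. frechet_derivative f (at x) b) = (\<lambda>x. grad f x \<bullet> b)"
      using assms by (auto simp: C1_def frechet_derivative_eq_grad)
    then show ?thesis
      using assms by (metis C1_def)
  qed
  then have "continuous_on UNIV (grad f)"
    by (subst continuous_on_componentwise) auto
  then show ?thesis
    using continuous_on_subset by blast
qed

lemma C1_iff_continuous_grad:
  fixes f :: "'a::euclidean_space \<Rightarrow> real"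
  shows "C1 f \<longleftrightarrow> (\<forall>x. f differentiable at x) \<and> continuous_on UNIV (grad f)"
  using C1_continuous_grad[of f UNIV]
  by (auto simp: C1_def frechet_derivative_eq_grad intro!: continuous_intros)

lemma C1_gderivI:
  fixes f :: "'a::euclidean_space \<Rightarrow> real"
  assumes "\<And>x. GDERIV f x :> F x" "continuous_on UNIV F"
  shows "C1 f"
proof -
  have "grad f = F"
    using assms(1) grad_eqI by blast
  moreover have "f differentiable at x" for x
    using assms(1)[of x] unfolding gderiv_def differentiable_def by blast
  ultimately show ?thesis
    using assms(2) C1_iff_continuous_grad by blast
qed

lemma frechet_derivative_scaleR:
  fixes u :: "'a::euclidean_space \<Rightarrow> real" and F :: "'a \<Rightarrow> 'b::real_normed_vector"
  assumes "u differentiable at x" "F differentiable at x"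
  shows "frechet_derivative (\<lambda>x. u x *\<^sub>R F x) (at x) v
    = u x *\<^sub>R frechet_derivative F (at x) v + (grad u x \<bullet> v) *\<^sub>R F x"
proof -
  have "((\<lambda>x. u x *\<^sub>R F x) has_derivative
      (\<lambda>h. u x *\<^sub>R frechet_derivative F (at x) h + frechet_derivative u (at x) h *\<^sub>R F x)) (at x)"
    using assms by (intro has_derivative_scaleR) (simp_all add: frechet_derivative_works[symmetric])
  from frechet_derivative_at[OF this, symmetric] show ?thesis
    using assms(1) by (simp add: frechet_derivative_eq_grad)
qed

lemma C1_scaleR:
  fixes u :: "'a::euclidean_space \<Rightarrow> real" and F :: "'a \<Rightarrow> 'b::real_normed_vector"
  assumes "C1 u" "C1 F"
  shows "C1 (\<lambda>x. u x *\<^sub>R F x)"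
proof -
  have "continuous_on UNIV (\<lambda>x. frechet_derivative F (at x) v)" for v
    using assms by (simp add: C1_def)
  moreover have "\<And>x. u differentiable at x" "\<And>x. F differentiable at x"
    using assms by (simp_all add: C1_def)
  ultimately show ?thesis
    using C1_continuous_on[OF assms(1)] C1_continuous_grad[OF assms(1)] C1_continuous_on[OF assms(2)]
    by (auto simp: C1_def frechet_derivative_scaleR intro!: continuous_intros)
qed

lemma divergence_scaleR:
  fixes u :: "'a::euclidean_space \<Rightarrow> real" and F :: "'a \<Rightarrow> 'a"
  assumes "u differentiable at x" "F differentiable at x"
  shows "divergence (\<lambda>x. u x *\<^sub>R F x) x = u x * divergence F x + grad u x \<bullet> F x"
  unfolding divergence_def
  by (subst euclidean_inner)
    (simp add: frechet_derivative_scaleR assms inner_add_left sum.distrib sum_distrib_left)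

lemma has_derivative_lincomb:
  fixes F G :: "'a::euclidean_space \<Rightarrow> 'b::real_normed_vector"
  assumes "F differentiable at x" "G differentiable at x"
  shows "((\<lambda>x. r *\<^sub>R F x + s *\<^sub>R G x) has_derivative
    (\<lambda>h. r *\<^sub>R frechet_derivative F (at x) h + s *\<^sub>R frechet_derivative G (at x) h)) (at x)"
  using assms by (intro has_derivative_add has_derivative_scaleR_right)
    (simp_all add: frechet_derivative_works[symmetric])

lemma C1_lincomb:
  fixes F G :: "'a::euclidean_space \<Rightarrow> 'b::real_normed_vector"
  assumes "C1 F" "C1 G"
  shows "C1 (\<lambda>x. r *\<^sub>R F x + s *\<^sub>R G x)"
proof -
  have d: "((\<lambda>x. r *\<^sub>R F x + s *\<^sub>R G x) has_derivative
    (\<lambda>h. r *\<^sub>R frechet_derivative F (at x) h + s *\<^sub>R frechet_derivative G (at x) h)) (at x)" for x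
    using assms by (intro has_derivative_lincomb) (simp_all add: C1_def)
  then have "(\<lambda>x. r *\<^sub>R F x + s *\<^sub>R G x) differentiable at x" for x
    unfolding differentiable_def by blast
  moreover have "continuous_on UNIV (\<lambda>x. r *\<^sub>R frechet_derivative F (at x) v + s *\<^sub>R frechet_derivative G (at x) v)" for v
    using assms unfolding C1_def by (intro continuous_intros) auto
  ultimately show ?thesis
    using frechet_derivative_at[OF d, symmetric] by (simp add: C1_def)
qed

lemma divergence_lincomb:
  fixes F G :: "'a::euclidean_space \<Rightarrow> 'a"
  assumes "F differentiable at x" "G differentiable at x"
  shows "divergence (\<lambda>x. r *\<^sub>R F x + s *\<^sub>R G x) x = r * divergence F x + s * divergence G x"
  using frechet_derivative_at[OF has_derivative_lincomb[OF assms], symmetric]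
  by (simp add: divergence_def inner_add_left sum.distrib sum_distrib_left)

lemma C1_continuous_divergence:
  fixes F :: "'a::euclidean_space \<Rightarrow> 'a"
  assumes "C1 F"
  shows "continuous_on S (divergence F)"
proof -
  have "continuous_on UNIV (divergence F)"
    using assms unfolding C1_def divergence_def[abs_def] by (intro continuous_intros) auto
  then show ?thesis
    using continuous_on_subset by blast
qed

lemma grad_zero_imp_constant:
  fixes f :: "'a::euclidean_space \<Rightarrow> real"
  assumes "\<And>x. GDERIV f x :> 0"
  shows "f x = f y"
  using assms has_derivative_zero_unique[of UNIV f x y] unfolding gderiv_def by auto

section \<open>The divergence theorem for compactly supported fields\<close>

lemma lborel_integral_translate:
  fixes f :: "'a::euclidean_space \<Rightarrow> real"
  assumes "f \<in> borel_measurable borel"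
  shows "(\<integral>x. f (c + x) \<partial>lborel) = (\<integral>x. f x \<partial>lborel)"
proof -
  have "(\<integral>x. f x \<partial>distr lborel borel ((+) c)) = (\<integral>x. f (c + x) \<partial>lborel)"
    using assms by (intro integral_distr) auto
  then show ?thesis
    by (simp add: lborel_distr_plus)
qed

lemma continuous_compact_support_integrable:
  fixes f :: "'a::euclidean_space \<Rightarrow> real"
  assumes "continuous_on UNIV f" "\<And>x. R < norm x \<Longrightarrow> f x = 0"
  shows "integrable lborel f"
proof -
  have "integrable lborel (\<lambda>x. indicator (cball 0 R) x *\<^sub>R f x)"
    using assms(1) continuous_on_subset by (intro borel_integrable_compact) auto
  moreover have "(\<lambda>x. indicator (cball 0 R) x *\<^sub>R f x) = f"
    using assms(2) by (auto simp: fun_eq_iff indicator_def not_le)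
  ultimately show ?thesis by simp
qed

text \<open>The difference quotients have integral zero by translation invariance, and they are
  uniformly bounded with support in a fixed ball.\<close>

lemma integral_directional_derivative_eq_0:
  fixes f :: "'a::euclidean_space \<Rightarrow> real"
  assumes f: "C1 f" and supp: "\<And>x. R < norm x \<Longrightarrow> f x = 0" and b: "norm b = 1"
  shows "(\<integral>x. grad f x \<bullet> b \<partial>lborel) = 0"
proof -
  have cont: "continuous_on UNIV (\<lambda>x. grad f x \<bullet> b)"
    using C1_continuous_grad[OF f] by (intro continuous_intros)
  have fcont: "continuous_on UNIV f"
    using C1_continuous_on[OF f] .
  have [measurable]: "f \<in> borel_measurable borel"
    using fcont by (rule borel_measurable_continuous_onI)
  \<comment> \<open>The step of a difference quotient is at most 1, so the quotients vanish off the
    ball of radius \<open>R + 1\<close>, and the intermediate points of the mean value theorem stay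
    in the ball of radius \<open>R + 2\<close>. A bound \<open>M\<close> on the larger ball
    therefore dominates them all.\<close>
  have "compact ((\<lambda>x. grad f x \<bullet> b) ` cball 0 (R + 2))"
    using cont continuous_on_subset by (intro compact_continuous_image) auto
  then have "bounded ((\<lambda>x. grad f x \<bullet> b) ` cball 0 (R + 2))"
    by (rule compact_imp_bounded)
  then obtain M where "\<forall>x\<in>cball 0 (R + 2). \<bar>grad f x \<bullet> b\<bar> \<le> M"
    by (auto simp: bounded_iff)
  then have M: "\<And>x. norm x \<le> R + 2 \<Longrightarrow> \<bar>grad f x \<bullet> b\<bar> \<le> M"
    by simp
  define q where "q n x = (f ((1 / Suc n) *\<^sub>R b + x) - f x) * Suc n" for n :: nat and x
  have int_f: "integrable lborel f"
    using continuous_compact_support_integrable[OF fcont supp] .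
  have dir: "((\<lambda>t. f (x + t *\<^sub>R b)) has_real_derivative grad f (x + t *\<^sub>R b) \<bullet> b) (at t)" for x t
  proof -
    have "((\<lambda>t. x + t *\<^sub>R b) has_derivative (\<lambda>s. s *\<^sub>R b)) (at t)"
      by (auto intro!: derivative_eq_intros)
    moreover have "(f has_derivative (\<lambda>h. h \<bullet> grad f (x + t *\<^sub>R b))) (at (x + t *\<^sub>R b))"
      using f gderiv_grad unfolding C1_def gderiv_def by blast
    ultimately have "((\<lambda>t. f (x + t *\<^sub>R b)) has_derivative (\<lambda>s. (s *\<^sub>R b) \<bullet> grad f (x + t *\<^sub>R b))) (at t)"
      by (rule has_derivative_compose)
    then show ?thesis
      by (simp add: has_field_derivative_def inner_commute mult.commute[of _ "_ \<bullet> _"])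
  qed
  have q0: "(\<integral>x. q n x \<partial>lborel) = 0" for n
  proof -
    have sh: "integrable lborel (\<lambda>x. f ((1 / Suc n) *\<^sub>R b + x))"
    proof (rule continuous_compact_support_integrable)
      show "continuous_on UNIV (\<lambda>x. f ((1 / Suc n) *\<^sub>R b + x))"
        by (intro continuous_on_compose2[OF fcont] continuous_intros) auto
      fix x :: 'a assume "R + 1 < norm x"
      moreover have "norm x \<le> norm ((1 / Suc n) *\<^sub>R b + x) + norm ((1 / Suc n) *\<^sub>R b)"
        using norm_triangle_ineq4[of "(1 / Suc n) *\<^sub>R b + x" "(1 / Suc n) *\<^sub>R b"] by simp
      moreover have "norm ((1 / Suc n) *\<^sub>R b) \<le> 1"
        using b by (simp add: divide_simps)
      ultimately show "f ((1 / Suc n) *\<^sub>R b + x) = 0"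
        by (intro supp) linarith
    qed
    show ?thesis
      unfolding q_def using int_f sh lborel_integral_translate[of f "(1 / Suc n) *\<^sub>R b"] by simp
  qed
  have "(\<lambda>n. \<integral>x. q n x \<partial>lborel) \<longlonglongrightarrow> (\<integral>x. grad f x \<bullet> b \<partial>lborel)"
  proof (rule integral_dominated_convergence)
    show "(\<lambda>x. grad f x \<bullet> b) \<in> borel_measurable lborel"
      using borel_measurable_continuous_onI[OF cont] by simp
    show "q n \<in> borel_measurable lborel" for n
      unfolding q_def by measurable
    show "integrable lborel (\<lambda>x. indicator (cball 0 (R + 1)) x *\<^sub>R M)"
      using borel_integrable_compact[of "cball 0 (R + 1)" "\<lambda>x. M"] by simp
    show "AE x in lborel. (\<lambda>n. q n x) \<longlonglongrightarrow> grad f x \<bullet> b"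
    proof (rule AE_I2)
      fix x
      have "((\<lambda>t. (f (x + t *\<^sub>R b) - f x) / t) \<longlongrightarrow> grad f x \<bullet> b) (at 0)"
        using dir[of x 0] by (simp add: has_field_derivative_iff)
      moreover have "(\<lambda>n. 1 / real (Suc n)) \<longlonglongrightarrow> 0"
        using LIMSEQ_inverse_real_of_nat by (simp add: inverse_eq_divide)
      ultimately have "(\<lambda>n. (f (x + (1 / real (Suc n)) *\<^sub>R b) - f x) / (1 / real (Suc n))) \<longlonglongrightarrow> grad f x \<bullet> b"
        unfolding tendsto_at_iff_sequentially comp_def
        by (elim allE[of _ "\<lambda>n. 1 / real (Suc n)"]) simp
      then show "(\<lambda>n. q n x) \<longlonglongrightarrow> grad f x \<bullet> b"
        by (simp add: q_def add.commute)
    qed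
    show "AE x in lborel. norm (q n x) \<le> indicator (cball 0 (R + 1)) x *\<^sub>R M" for n
    proof (rule AE_I2)
      fix x
      define s where "s = 1 / real (Suc n)"
      have s: "0 < s" "s \<le> 1"
        by (auto simp: s_def divide_simps)
      have bd: "norm (t *\<^sub>R b) \<le> 1" if "0 \<le> t" "t \<le> s" for t
        using that s b by simp
      have q: "q n x = (f (x + s *\<^sub>R b) - f x) / s"
        by (simp add: q_def s_def add.commute)
      show "norm (q n x) \<le> indicator (cball 0 (R + 1)) x *\<^sub>R M"
      proof (cases "norm x \<le> R + 1")
        case True
        obtain t where t: "0 < t" "t < s" "f (x + s *\<^sub>R b) - f (x + 0 *\<^sub>R b) = (s - 0) * (grad f (x + t *\<^sub>R b) \<bullet> b)"
          using MVT2[OF s(1), of "\<lambda>t. f (x + t *\<^sub>R b)" "\<lambda>t. grad f (x + t *\<^sub>R b) \<bullet> b"] dir by blast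
        have "norm (x + t *\<^sub>R b) \<le> R + 2"
          using norm_triangle_ineq[of x "t *\<^sub>R b"] bd[of t] t True by linarith
        with M t s True show ?thesis
          by (simp add: q)
      next
        case False
        have "norm x \<le> norm (x + s *\<^sub>R b) + norm (s *\<^sub>R b)"
          using norm_triangle_ineq4[of "x + s *\<^sub>R b" "s *\<^sub>R b"] by simp
        with False bd[of s] s have "R < norm (x + s *\<^sub>R b)" "R < norm x"
          by linarith+
        then show ?thesis
          using False by (simp add: q supp)
      qed
    qed
  qed
  then show ?thesis
    by (simp add: q0 LIMSEQ_const_iff)
qed

lemma grad_eq_0_outside_support:
  fixes f :: "'a::euclidean_space \<Rightarrow> real"
  assumes "\<And>x. R < norm x \<Longrightarrow> f x = 0" "R < norm x"
  shows "grad f x = 0"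
proof (rule grad_eqI)
  have "open {x::'a. R < norm x}"
    by (intro open_Collect_less continuous_intros)
  then have "(f has_derivative (\<lambda>h. h \<bullet> 0)) (at x)"
    by (rule has_derivative_transform_within_open[rotated]) (use assms in auto)
  then show "GDERIV f x :> 0"
    by (simp add: gderiv_def)
qed

text \<open>Each summand of the divergence is the derivative of the scalar function
  \<open>F x \<bullet> b\<close> along the same \<open>b\<close>, so the directional result applies
  one basis vector at a time.\<close>

lemma integral_divergence_compact_support:
  fixes F :: "'a::euclidean_space \<Rightarrow> 'a"
  assumes F: "C1 F" and supp: "\<And>x. R < norm x \<Longrightarrow> F x = 0"
  shows "(\<integral>x. divergence F x \<partial>lborel) = 0"
proof -
  have comp: "C1 (\<lambda>x. F x \<bullet> b)"
    and fd: "frechet_derivative F (at x) b \<bullet> b = grad (\<lambda>x. F x \<bullet> b) x \<bullet> b" for b x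
  proof -
    have "((\<lambda>x. F x \<bullet> b) has_derivative (\<lambda>h. frechet_derivative F (at x) h \<bullet> b)) (at x)" for x
      using F by (intro has_derivative_inner_left) (simp add: C1_def frechet_derivative_works[symmetric])
    then have d: "(\<lambda>x. F x \<bullet> b) differentiable at x"
      "frechet_derivative (\<lambda>x. F x \<bullet> b) (at x) = (\<lambda>h. frechet_derivative F (at x) h \<bullet> b)" for x
      by (auto simp: differentiable_def frechet_derivative_at[symmetric])
    then show "C1 (\<lambda>x. F x \<bullet> b)"
      using F by (auto simp: C1_def intro!: continuous_intros)
    show "frechet_derivative F (at x) b \<bullet> b = grad (\<lambda>x. F x \<bullet> b) x \<bullet> b"
      using frechet_derivative_eq_grad[OF d(1)] d(2) by metis
  qed
  have "(\<integral>x. divergence F x \<partial>lborel) = (\<Sum>b\<in>Basis. \<integral>x. grad (\<lambda>x. F x \<bullet> b) x \<bullet> b \<partial>lborel)"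
    unfolding divergence_def fd
  proof (rule Bochner_Integration.integral_sum)
    fix b :: 'a
    have "continuous_on UNIV (\<lambda>x. grad (\<lambda>x. F x \<bullet> b) x \<bullet> b)"
      using C1_continuous_grad[OF comp] by (intro continuous_intros)
    moreover have "grad (\<lambda>x. F x \<bullet> b) x \<bullet> b = 0" if "R < norm x" for x
      using grad_eq_0_outside_support[OF _ that, of "\<lambda>x. F x \<bullet> b"] supp by simp
    ultimately show "integrable lborel (\<lambda>x. grad (\<lambda>x. F x \<bullet> b) x \<bullet> b)"
      by (rule continuous_compact_support_integrable)
  qed
  also have "\<dots> = 0"
    using integral_directional_derivative_eq_0[OF comp, of R] supp by (intro sum.neutral) auto
  finally show ?thesis .
qed

section \<open>Continuously differentiable cutoff functions\<close>

text \<open>Squaring the positive part removes its kink: at 0 the difference quotient is bounded by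
  the absolute value of the increment. This is what makes \<open>cutoff\<close> a \<open>C1\<close>
  function.\<close>

lemma has_real_derivative_max_0_power2:
  "((\<lambda>s::real. (max 0 s)\<^sup>2) has_real_derivative 2 * max 0 s) (at s)"
proof -
  consider "s < 0" | "s = 0" | "0 < s" by linarith
  then show ?thesis
  proof cases
    case 1
    have "((\<lambda>s::real. (max 0 s)\<^sup>2) has_real_derivative 0) (at s)"
      by (rule has_field_derivative_transform_within_open[where f = "\<lambda>s. 0" and S = "{..<0}"])
        (use 1 in auto)
    with 1 show ?thesis by simp
  next
    case 2
    have "((\<lambda>h::real. (max 0 h)\<^sup>2 / h) \<longlongrightarrow> 0) (at 0)"
    proof (rule Lim_null_comparison)
      show "\<forall>\<^sub>F h::real in at 0. norm ((max 0 h)\<^sup>2 / h) \<le> \<bar>h\<bar>"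
        by (intro always_eventually) (auto simp: max_def power2_eq_square)
      show "((\<lambda>h::real. \<bar>h\<bar>) \<longlongrightarrow> 0) (at 0)"
        by (auto intro!: tendsto_eq_intros)
    qed
    with 2 show ?thesis
      by (simp add: has_field_derivative_iff)
  next
    case 3
    have "((\<lambda>s::real. (max 0 s)\<^sup>2) has_real_derivative 2 * s) (at s)"
      by (rule has_field_derivative_transform_within_open[where f = "\<lambda>s. s\<^sup>2" and S = "{0<..}"])
        (use 3 in \<open>auto intro!: derivative_eq_intros\<close>)
    with 3 show ?thesis by simp
  qed
qed

text \<open>The bump is built on \<open>x \<bullet> x\<close> instead of the norm, which avoids a
  singularity at the origin. The outer square makes it \<open>C1\<close> across the sphere of radius
  \<open>R\<close>.\<close>

definition cutoff :: "real \<Rightarrow> 'a::euclidean_space \<Rightarrow> real" where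
  "cutoff R x = (max 0 (1 - (x \<bullet> x) / R\<^sup>2))\<^sup>2"

lemma gderiv_cutoff:
  "GDERIV (cutoff R) x :> (- 4 * max 0 (1 - (x \<bullet> x) / R\<^sup>2) / R\<^sup>2) *\<^sub>R x"
proof -
  have "((\<lambda>s. 1 - s / R\<^sup>2) has_real_derivative 0 - 1 / R\<^sup>2) (at (x \<bullet> x))"
    by (intro DERIV_diff DERIV_const DERIV_cdivide DERIV_ident)
  from DERIV_chain2[OF has_real_derivative_max_0_power2 this]
  have "((\<lambda>s. (max 0 (1 - s / R\<^sup>2))\<^sup>2) has_real_derivative
      - 2 * max 0 (1 - (x \<bullet> x) / R\<^sup>2) / R\<^sup>2) (at (x \<bullet> x))"
    by simp
  moreover have "GDERIV (\<lambda>x::'a. x \<bullet> x) x :> 2 *\<^sub>R x"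
    unfolding gderiv_def by (auto intro!: derivative_eq_intros simp: inner_commute)
  ultimately have "GDERIV (\<lambda>x. (max 0 (1 - (x \<bullet> x) / R\<^sup>2))\<^sup>2) x :>
      (- 2 * max 0 (1 - (x \<bullet> x) / R\<^sup>2) / R\<^sup>2) *\<^sub>R 2 *\<^sub>R x"
    by (rule GDERIV_DERIV_compose[rotated])
  then show ?thesis
    by (simp add: cutoff_def[abs_def])
qed

lemma C1_cutoff: "C1 (cutoff R)"
  by (rule C1_gderivI[OF gderiv_cutoff]) (unfold divide_inverse,
      intro continuous_on_scaleR continuous_on_mult continuous_on_max continuous_on_diff
        continuous_on_const continuous_on_inner continuous_on_id)

lemma cutoff_bounds: "0 \<le> cutoff R x" "cutoff R x \<le> 1"
  by (auto simp: cutoff_def max_def intro!: power_le_one)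

lemma cutoff_eq_0:
  assumes "0 < R" "R < norm x"
  shows "cutoff R x = 0"
proof -
  have "R\<^sup>2 < x \<bullet> x"
    using assms by (simp add: power2_norm_eq_inner[symmetric] power_strict_mono)
  then show ?thesis
    using assms by (simp add: cutoff_def max_def divide_simps)
qed

text \<open>The factor 1/R makes the error caused by cutting off disappear in the limit. Inside the
  ball the positive part is at most 1 and the norm of \<open>x\<close> at most \<open>R\<close>;
  outside, the gradient vanishes.\<close>

lemma norm_grad_cutoff_le:
  assumes "0 < R"
  shows "norm (grad (cutoff R) x) \<le> 4 / R"
proof (cases "norm x \<le> R")
  case True
  have "grad (cutoff R) x = (- 4 * max 0 (1 - (x \<bullet> x) / R\<^sup>2) / R\<^sup>2) *\<^sub>R x"
    by (rule grad_eqI[OF gderiv_cutoff])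
  then have "norm (grad (cutoff R) x) = 4 * max 0 (1 - (x \<bullet> x) / R\<^sup>2) * norm x / R\<^sup>2"
    by (simp add: abs_mult)
  also have "\<dots> \<le> 4 * 1 * R / R\<^sup>2"
    using True assms by (intro divide_right_mono mult_mono) auto
  finally show ?thesis
    using assms by (simp add: power2_eq_square)
next
  case False
  then have "grad (cutoff R) x = 0"
    using assms by (intro grad_eq_0_outside_support[where R = R]) (auto intro: cutoff_eq_0)
  then show ?thesis
    using assms by simp
qed

lemma cutoff_tendsto_1: "(\<lambda>n. cutoff (real (Suc n)) x) \<longlonglongrightarrow> 1"
proof -
  have "(\<lambda>n. (x \<bullet> x) * (inverse (real (Suc n)))\<^sup>2) \<longlonglongrightarrow> (x \<bullet> x) * 0\<^sup>2"
    by (intro tendsto_intros LIMSEQ_inverse_real_of_nat)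
  then have "(\<lambda>n. (max 0 (1 - (x \<bullet> x) * (inverse (real (Suc n)))\<^sup>2))\<^sup>2) \<longlonglongrightarrow> (max 0 (1 - (x \<bullet> x) * 0\<^sup>2))\<^sup>2"
    by (intro tendsto_power tendsto_max tendsto_diff tendsto_const)
  then show ?thesis
    by (simp add: cutoff_def divide_inverse power_inverse)
qed

section \<open>Divergence theorem and integration by parts under integrability alone\<close>

lemma C1_borel_measurable:
  fixes f :: "'a::euclidean_space \<Rightarrow> 'b::real_normed_vector"
  assumes "C1 f"
  shows "f \<in> borel_measurable borel"
  using C1_continuous_on[OF assms] by (rule borel_measurable_continuous_onI)

lemma C1_borel_measurable_grad:
  assumes "C1 f"
  shows "grad f \<in> borel_measurable borel"
  using C1_continuous_grad[OF assms] by (rule borel_measurable_continuous_onI)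

lemma C1_borel_measurable_divergence:
  assumes "C1 F"
  shows "divergence F \<in> borel_measurable borel"
  using C1_continuous_divergence[OF assms] by (rule borel_measurable_continuous_onI)

text \<open>The compactly supported case applies to \<open>cut n x *\<^sub>R F x\<close>. In its
  divergence the gradient of the cutoff contributes at most
  \<open>4 / real (Suc n) * norm (F x)\<close>, which tends to 0, and the other term tends to
  \<open>divergence F x\<close>; both limits are dominated.\<close>

lemma integral_divergence_eq_0:
  fixes F :: "'a::euclidean_space \<Rightarrow> 'a"
  assumes F: "C1 F" and int: "integrable lborel F" "integrable lborel (divergence F)"
  shows "(\<integral>x. divergence F x \<partial>lborel) = 0"
proof -
  \<comment> \<open>The radii start at 1. For radius 0 the convention that division by zero gives
    zero would make \<open>cutoff\<close> identically 1, with no compact support.\<close>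
  define cut :: "nat \<Rightarrow> 'a \<Rightarrow> real" where "cut n = cutoff (real (Suc n))" for n
  have cut: "C1 (cut n)" for n
    by (simp add: cut_def C1_cutoff)
  note [measurable] = C1_borel_measurable[OF F] C1_borel_measurable_divergence[OF F]
    C1_borel_measurable[OF cut] C1_borel_measurable_grad[OF cut]
  define s where "s n x = cut n x * divergence F x + grad (cut n) x \<bullet> F x" for n x
  have gb: "norm (grad (cut n) x \<bullet> F x) \<le> 4 / real (Suc n) * norm (F x)" for n x
    using Cauchy_Schwarz_ineq2[of "grad (cut n) x" "F x"] norm_grad_cutoff_le[of "real (Suc n)" x]
    unfolding cut_def by (smt (verit) mult_right_mono norm_ge_zero of_nat_0_less_iff real_norm_def zero_less_Suc)
  have "divergence (\<lambda>x. cut n x *\<^sub>R F x) = s n" for n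
    using F cut by (auto simp: s_def C1_def divergence_scaleR)
  moreover have "(\<integral>x. divergence (\<lambda>x. cut n x *\<^sub>R F x) x \<partial>lborel) = 0" for n
    by (intro integral_divergence_compact_support[where R = "real (Suc n)"] C1_scaleR cut F)
      (simp add: cut_def cutoff_eq_0)
  ultimately have s0: "(\<integral>x. s n x \<partial>lborel) = 0" for n
    by simp
  have "(\<lambda>n. \<integral>x. s n x \<partial>lborel) \<longlonglongrightarrow> (\<integral>x. divergence F x \<partial>lborel)"
  proof (rule integral_dominated_convergence)
    show "divergence F \<in> borel_measurable lborel" "\<And>n. s n \<in> borel_measurable lborel"
      unfolding s_def by measurable
    show "integrable lborel (\<lambda>x. norm (divergence F x) + 4 * norm (F x))"
      using int by simp
    show "AE x in lborel. (\<lambda>n. s n x) \<longlonglongrightarrow> divergence F x"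
    proof (rule AE_I2)
      fix x
      have "(\<lambda>n. 4 / real (Suc n) * norm (F x)) \<longlonglongrightarrow> 4 * 0 * norm (F x)"
        unfolding divide_inverse by (intro tendsto_intros LIMSEQ_inverse_real_of_nat)
      then have "(\<lambda>n. grad (cut n) x \<bullet> F x) \<longlonglongrightarrow> 0"
        using gb by (intro Lim_null_comparison[of "\<lambda>n. grad (cut n) x \<bullet> F x"
              "\<lambda>n. 4 / real (Suc n) * norm (F x)"] always_eventually) auto
      moreover have "(\<lambda>n. cut n x * divergence F x) \<longlonglongrightarrow> 1 * divergence F x"
        unfolding cut_def by (intro tendsto_intros cutoff_tendsto_1)
      ultimately show "(\<lambda>n. s n x) \<longlonglongrightarrow> divergence F x"
        unfolding s_def using tendsto_add by fastforce
    qed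
    show "AE x in lborel. norm (s n x) \<le> norm (divergence F x) + 4 * norm (F x)" for n
    proof (rule AE_I2)
      fix x
      have "norm (cut n x * divergence F x) \<le> 1 * norm (divergence F x)"
        unfolding norm_mult using cutoff_bounds[of "real (Suc n)" x]
        by (intro mult_right_mono) (auto simp: cut_def)
      moreover have "4 / real (Suc n) * norm (F x) \<le> 4 * norm (F x)"
        by (intro mult_right_mono) (auto simp: divide_simps)
      ultimately show "norm (s n x) \<le> norm (divergence F x) + 4 * norm (F x)"
        unfolding s_def using gb[of n x]
          norm_triangle_ineq[of "cut n x * divergence F x" "grad (cut n) x \<bullet> F x"] by linarith
    qed
  qed
  then show ?thesis
    by (simp add: s0 LIMSEQ_const_iff)
qed

text \<open>The field \<^term>\<open>\<lambda>x. u x *\<^sub>R F x\<close> need not be integrable, so \<^term>\<open>u\<close> is first replaced by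
  the bounded functions \<open>u / (1 + \<epsilon> u\<^sup>2)\<close>.\<close>

lemma integration_by_parts_divergence:
  fixes F :: "'a::euclidean_space \<Rightarrow> 'a"
  assumes u: "C1 u" and F: "C1 F" and int: "integrable lborel F"
    "integrable lborel (\<lambda>x. u x * divergence F x)" "integrable lborel (\<lambda>x. grad u x \<bullet> F x)"
  shows "(\<integral>x. u x * divergence F x \<partial>lborel) = - (\<integral>x. grad u x \<bullet> F x \<partial>lborel)"
proof -
  define \<epsilon> where "\<epsilon> n = inverse (real (Suc n))" for n
  have \<epsilon>: "0 < \<epsilon> n" "\<epsilon> n \<le> 1" for n
    by (auto simp: \<epsilon>_def divide_simps)
  have lim: "\<epsilon> \<longlonglongrightarrow> 0"
    unfolding \<epsilon>_def by (rule LIMSEQ_inverse_real_of_nat)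
  have pos: "1 \<le> 1 + \<epsilon> n * y\<^sup>2" for n y
    using \<epsilon>[of n] by simp
  have nz: "1 + \<epsilon> n * y\<^sup>2 \<noteq> 0" for n y
    using pos[of n y] by linarith
  \<comment> \<open>A damped identity with three bounds. Its absolute value is at most that of
    \<open>y\<close> and its derivative is at most 1 in absolute value, which dominates the
    integrands uniformly in \<open>n\<close>. It is also bounded by \<open>1 / \<epsilon> n\<close>,
    which makes the truncated field integrable for each fixed \<open>n\<close>.\<close>
  define \<tau> where "\<tau> n y = y / (1 + \<epsilon> n * y\<^sup>2)" for n y
  define \<tau>' where "\<tau>' n y = (1 - \<epsilon> n * y\<^sup>2) / (1 + \<epsilon> n * y\<^sup>2)\<^sup>2" for n y
  have d\<tau>: "(\<tau> n has_real_derivative \<tau>' n y) (at y)" for n y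
    unfolding \<tau>_def \<tau>'_def
    by (rule derivative_eq_intros refl nz)+ (simp add: power2_eq_square algebra_simps)
  have \<tau>_le: "\<bar>\<tau> n y\<bar> \<le> \<bar>y\<bar>" for n y
    using pos[of n y] nz[of n y] mult_left_mono[of 1 "1 + \<epsilon> n * y\<^sup>2" "\<bar>y\<bar>"]
    unfolding \<tau>_def abs_divide by (simp add: divide_le_eq)
  have frac: "z / D \<le> 1 / e" if "0 < D" "0 < e" "e * z \<le> D" for z D e :: real
    using that by (simp add: field_simps)
  have \<tau>_bd: "\<bar>\<tau> n y\<bar> \<le> 1 / \<epsilon> n" for n y
  proof -
    have "\<epsilon> n * \<bar>y\<bar> \<le> 1 + \<epsilon> n * y\<^sup>2"
    proof (cases "\<bar>y\<bar> \<le> 1")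
      case True
      then have "\<epsilon> n * \<bar>y\<bar> \<le> 1 * 1"
        using \<epsilon>[of n] by (intro mult_mono) auto
      with \<epsilon>[of n] show ?thesis by (smt (verit) mult_nonneg_nonneg zero_le_power2)
    next
      case False
      then have "\<bar>y\<bar> * 1 \<le> \<bar>y\<bar> * \<bar>y\<bar>"
        by (intro mult_left_mono) auto
      then have "\<epsilon> n * \<bar>y\<bar> \<le> \<epsilon> n * y\<^sup>2"
        using \<epsilon>[of n] by (simp add: power2_eq_square)
      then show ?thesis by simp
    qed
    then show ?thesis
      using frac[of "1 + \<epsilon> n * y\<^sup>2" "\<epsilon> n" "\<bar>y\<bar>"] pos[of n y] \<epsilon>[of n]
      unfolding \<tau>_def abs_divide by linarith
  qed
  have \<tau>'_bd: "\<bar>\<tau>' n y\<bar> \<le> 1" for n y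
  proof -
    have "\<bar>1 - \<epsilon> n * y\<^sup>2\<bar> \<le> 1 + \<epsilon> n * y\<^sup>2"
      using pos[of n y] by linarith
    also have "\<dots> \<le> (1 + \<epsilon> n * y\<^sup>2)\<^sup>2"
      using pos[of n y] by (simp add: self_le_power)
    finally show ?thesis
      using frac[of "(1 + \<epsilon> n * y\<^sup>2)\<^sup>2" 1 "\<bar>1 - \<epsilon> n * y\<^sup>2\<bar>"] nz[of n y]
      unfolding \<tau>'_def abs_divide by simp
  qed
  define v where "v n x = \<tau> n (u x)" for n x
  have gv: "GDERIV (v n) x :> \<tau>' n (u x) *\<^sub>R grad u x" for n x
    unfolding v_def using u d\<tau> by (intro GDERIV_DERIV_compose gderiv_grad) (auto simp: C1_def)
  have v: "C1 (v n)" for n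
  proof (rule C1_gderivI[OF gv])
    show "continuous_on UNIV (\<lambda>x. \<tau>' n (u x) *\<^sub>R grad u x)"
      unfolding \<tau>'_def using C1_continuous_on[OF u] C1_continuous_grad[OF u] nz
      by (intro continuous_intros) auto
  qed
  have grad_v: "grad (v n) x = \<tau>' n (u x) *\<^sub>R grad u x" for n x
    by (rule grad_eqI[OF gv])
  note [measurable] = C1_borel_measurable[OF F] C1_borel_measurable_divergence[OF F]
    C1_borel_measurable[OF v] C1_borel_measurable_grad[OF v] C1_borel_measurable[OF u] C1_borel_measurable_grad[OF u]
  define s where "s n x = v n x * divergence F x + grad (v n) x \<bullet> F x" for n x
  have [measurable]: "s n \<in> borel_measurable borel" for n
    unfolding s_def[abs_def] by measurable
  let ?w = "\<lambda>x. norm (u x * divergence F x) + norm (grad u x \<bullet> F x)"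
  have s_le: "norm (s n x) \<le> ?w x" for n x
  proof -
    have "norm (v n x * divergence F x) \<le> norm (u x * divergence F x)"
      unfolding norm_mult v_def using \<tau>_le by (intro mult_right_mono) auto
    moreover have "norm (grad (v n) x \<bullet> F x) \<le> 1 * norm (grad u x \<bullet> F x)"
      unfolding grad_v inner_scaleR_left norm_mult using \<tau>'_bd by (intro mult_right_mono) auto
    ultimately show ?thesis
      unfolding s_def using norm_triangle_ineq[of "v n x * divergence F x" "grad (v n) x \<bullet> F x"]
      by linarith
  qed
  have w: "integrable lborel ?w"
    using int by simp
  have s_int: "integrable lborel (s n)" for n
    by (rule Bochner_Integration.integrable_bound[OF w]) (use s_le in \<open>auto intro: order_trans\<close>)
  have div: "divergence (\<lambda>x. v n x *\<^sub>R F x) = s n" for n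
    using F v by (auto simp: s_def C1_def divergence_scaleR)
  have s0: "(\<integral>x. s n x \<partial>lborel) = 0" for n
  proof -
    have "integrable lborel (\<lambda>x. v n x *\<^sub>R F x)"
    proof (rule Bochner_Integration.integrable_bound)
      show "integrable lborel (\<lambda>x. (1 / \<epsilon> n) *\<^sub>R F x)"
        using int by simp
      show "AE x in lborel. norm (v n x *\<^sub>R F x) \<le> norm ((1 / \<epsilon> n) *\<^sub>R F x)"
        unfolding norm_scaleR v_def using \<tau>_bd \<epsilon>
        by (intro AE_I2 mult_right_mono) (auto simp: abs_of_pos)
    qed simp
    then show ?thesis
      using integral_divergence_eq_0[OF C1_scaleR[OF v F], of n] s_int by (simp add: div)
  qed
  have "(\<lambda>n. \<integral>x. s n x \<partial>lborel) \<longlonglongrightarrow> (\<integral>x. u x * divergence F x + grad u x \<bullet> F x \<partial>lborel)"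
  proof (rule integral_dominated_convergence[OF _ _ w])
    show "AE x in lborel. (\<lambda>n. s n x) \<longlonglongrightarrow> u x * divergence F x + grad u x \<bullet> F x"
    proof (rule AE_I2)
      fix x
      have "(\<lambda>n. v n x) \<longlonglongrightarrow> u x / (1 + 0 * (u x)\<^sup>2)"
        unfolding v_def \<tau>_def by (intro tendsto_intros lim) simp
      moreover have "(\<lambda>n. \<tau>' n (u x)) \<longlonglongrightarrow> (1 - 0 * (u x)\<^sup>2) / (1 + 0 * (u x)\<^sup>2)\<^sup>2"
        unfolding \<tau>'_def by (intro tendsto_intros lim) simp
      ultimately have "(\<lambda>n. v n x * divergence F x + \<tau>' n (u x) * (grad u x \<bullet> F x))
          \<longlonglongrightarrow> u x * divergence F x + 1 * (grad u x \<bullet> F x)"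
        by (intro tendsto_intros) simp_all
      then show "(\<lambda>n. s n x) \<longlonglongrightarrow> u x * divergence F x + grad u x \<bullet> F x"
        by (simp add: s_def grad_v)
    qed
    show "AE x in lborel. norm (s n x) \<le> ?w x" for n
      using s_le by (intro AE_I2)
  qed simp_all
  then have "(\<integral>x. u x * divergence F x + grad u x \<bullet> F x \<partial>lborel) = 0"
    by (simp add: s0 LIMSEQ_const_iff)
  then show ?thesis
    using int by simp
qed

section \<open>Vanishing integrals and differentiation under the integral sign\<close>

text \<open>The set where a continuous function is nonzero is open, and a nonempty open set is not
  negligible. This turns equality of gradient fields almost everywhere into equality at every
  point.\<close>

lemma continuous_integral_eq_0_imp_0:
  fixes f :: "'a::euclidean_space \<Rightarrow> real"
  assumes "continuous_on UNIV f" "\<And>x. 0 \<le> f x" "integrable lborel f" "(\<integral>x. f x \<partial>lborel) = 0"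
  shows "f x = 0"
proof -
  have op: "open {x. f x \<noteq> 0}"
    using assms(1) by (intro open_Collect_neq continuous_on_const)
  have "AE x in lborel. f x = 0"
    using assms by (subst integral_nonneg_eq_0_iff_AE[symmetric]) auto
  then have "{x. f x \<noteq> 0} \<in> null_sets lborel"
    using op by (subst AE_iff_null_sets) (auto simp: borel_open)
  then have "negligible {x. f x \<noteq> 0}"
    by (simp add: negligible_iff_null_sets null_sets_completionI)
  then show ?thesis
    using open_not_negligible[OF op] by blast
qed

text \<open>On a ball around \<theta> inside both \<open>S\<close> and the domination range,
  convexity and the mean value inequality bound every difference quotient by \<open>g\<close>.
  Dominated convergence then applies along each sequence of parameters tending to \<theta>.\<close>

lemma has_real_derivative_integral_parametric:
  fixes f :: "real \<Rightarrow> 'a \<Rightarrow> real"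
  assumes S: "open S" "\<theta> \<in> S"
    and int: "\<And>t. t \<in> S \<Longrightarrow> integrable M (f t)"
    and meas: "f' \<theta> \<in> borel_measurable M"
    and deriv: "\<And>t x. t \<in> S \<Longrightarrow> ((\<lambda>t. f t x) has_real_derivative f' t x) (at t)"
    and dom: "0 < \<epsilon>" "integrable M g" "\<And>t x. t \<in> S \<Longrightarrow> \<bar>t - \<theta>\<bar> < \<epsilon> \<Longrightarrow> \<bar>f' t x\<bar> \<le> g x"
  shows "((\<lambda>t. \<integral>x. f t x \<partial>M) has_real_derivative (\<integral>x. f' \<theta> x \<partial>M)) (at \<theta>)"
proof -
  obtain \<delta>' where "0 < \<delta>'" "ball \<theta> \<delta>' \<subseteq> S"
    using S open_contains_ball by blast
  define B where "B = ball \<theta> (min \<delta>' \<epsilon>)"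
  have B: "open B" "\<theta> \<in> B" "B \<subseteq> S" "convex B"
    using \<open>0 < \<delta>'\<close> \<open>ball \<theta> \<delta>' \<subseteq> S\<close> dom(1) by (auto simp: B_def)
  have gB: "\<bar>f' t x\<bar> \<le> g x" if "t \<in> B" for t x
    using that B dom(3)[of t x] by (auto simp: B_def dist_real_def)
  have lip: "\<bar>f t x - f \<theta> x\<bar> \<le> g x * \<bar>t - \<theta>\<bar>" if "t \<in> B" for t x
  proof -
    have "norm (f t x - f \<theta> x) \<le> g x * norm (t - \<theta>)"
    proof (rule field_differentiable_bound[OF \<open>convex B\<close>])
      show "((\<lambda>t. f t x) has_field_derivative f' t x) (at t within B)" if "t \<in> B" for t
        using deriv[of t x] that B by (auto intro: has_field_derivative_at_within)
    qed (use that B gB in auto)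
    then show ?thesis by simp
  qed
  have "((\<lambda>t. ((\<integral>x. f t x \<partial>M) - (\<integral>x. f \<theta> x \<partial>M)) / (t - \<theta>)) \<longlongrightarrow> (\<integral>x. f' \<theta> x \<partial>M)) (at \<theta> within B)"
    unfolding tendsto_at_iff_sequentially comp_def
  proof (intro allI impI)
    fix X :: "nat \<Rightarrow> real"
    assume X: "\<forall>i. X i \<in> B - {\<theta>}" and lim: "X \<longlonglongrightarrow> \<theta>"
    have "(\<lambda>n. \<integral>x. (f (X n) x - f \<theta> x) / (X n - \<theta>) \<partial>M) \<longlonglongrightarrow> (\<integral>x. f' \<theta> x \<partial>M)"
    proof (rule integral_dominated_convergence[OF meas _ dom(2)])
      show "(\<lambda>x. (f (X n) x - f \<theta> x) / (X n - \<theta>)) \<in> borel_measurable M" for n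
        using int[of "X n"] int[of \<theta>] X B S by (auto intro!: borel_measurable_divide borel_measurable_diff)
      show "AE x in M. (\<lambda>n. (f (X n) x - f \<theta> x) / (X n - \<theta>)) \<longlonglongrightarrow> f' \<theta> x"
      proof (rule AE_I2)
        fix x
        have "((\<lambda>t. (f t x - f \<theta> x) / (t - \<theta>)) \<longlongrightarrow> f' \<theta> x) (at \<theta>)"
          using deriv[OF S(2)] by (simp add: has_field_derivative_iff)
        then show "(\<lambda>n. (f (X n) x - f \<theta> x) / (X n - \<theta>)) \<longlonglongrightarrow> f' \<theta> x"
          using X lim unfolding tendsto_at_iff_sequentially comp_def by auto
      qed
      show "AE x in M. norm ((f (X n) x - f \<theta> x) / (X n - \<theta>)) \<le> g x" for n
      proof (rule AE_I2)
        fix x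
        show "norm ((f (X n) x - f \<theta> x) / (X n - \<theta>)) \<le> g x"
          using lip[of "X n" x] X by (simp add: abs_divide divide_le_eq)
      qed
    qed
    moreover have "(\<integral>x. (f (X n) x - f \<theta> x) / (X n - \<theta>) \<partial>M)
        = ((\<integral>x. f (X n) x \<partial>M) - (\<integral>x. f \<theta> x \<partial>M)) / (X n - \<theta>)" for n
      using int[of "X n"] int[of \<theta>] X B S by (auto simp: subset_iff)
    ultimately show "(\<lambda>n. ((\<integral>x. f (X n) x \<partial>M) - (\<integral>x. f \<theta> x \<partial>M)) / (X n - \<theta>)) \<longlonglongrightarrow> (\<integral>x. f' \<theta> x \<partial>M)"
      by (simp only:)
  qed
  then show ?thesis
    using at_within_open[OF B(2,1)] by (simp add: has_field_derivative_iff)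
qed

section \<open>Square-integrable fields with respect to a positive density\<close>

text \<open>Cauchy--Schwarz followed by the bound of a product by the sum of the squares dominates
  the cross term.\<close>

lemma integrable_weighted_inner:
  fixes U V :: "'a::euclidean_space \<Rightarrow> 'a" and r :: "'a \<Rightarrow> real"
  assumes [measurable]: "U \<in> borel_measurable borel" "V \<in> borel_measurable borel" "r \<in> borel_measurable borel"
    and "\<And>x. 0 \<le> r x" "integrable lborel (\<lambda>x. r x * (norm (U x))\<^sup>2)" "integrable lborel (\<lambda>x. r x * (norm (V x))\<^sup>2)"
  shows "integrable lborel (\<lambda>x. r x * (U x \<bullet> V x))"
proof (rule Bochner_Integration.integrable_bound)
  show "integrable lborel (\<lambda>x. r x * (norm (U x))\<^sup>2 + r x * (norm (V x))\<^sup>2)"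
    using assms by simp
  show "AE x in lborel. norm (r x * (U x \<bullet> V x)) \<le> norm (r x * (norm (U x))\<^sup>2 + r x * (norm (V x))\<^sup>2)"
  proof (rule AE_I2)
    fix x
    have "\<bar>U x \<bullet> V x\<bar> \<le> norm (U x) * norm (V x)"
      by (rule Cauchy_Schwarz_ineq2)
    also have "\<dots> \<le> (norm (U x))\<^sup>2 + (norm (V x))\<^sup>2"
      using sum_squares_bound[of "norm (U x)" "norm (V x)"]
        mult_nonneg_nonneg[OF norm_ge_zero norm_ge_zero, of "U x" "V x"] by linarith
    finally have "r x * \<bar>U x \<bullet> V x\<bar> \<le> r x * ((norm (U x))\<^sup>2 + (norm (V x))\<^sup>2)"
      using assms(4) by (intro mult_left_mono)
    then show "norm (r x * (U x \<bullet> V x)) \<le> norm (r x * (norm (U x))\<^sup>2 + r x * (norm (V x))\<^sup>2)"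
      using assms(4)[of x] by (simp add: abs_mult distrib_left)
  qed
qed simp

text \<open>Integration by parts for the field \<open>r x *\<^sub>R G x\<close>. That field is
  integrable since \<open>r\<close> has finite mass and \<open>norm (G x)\<close> is at most one
  plus its square; the gradient term is a cross term of two square-integrable fields.\<close>

lemma weighted_integration_by_parts:
  fixes r u :: "'a::euclidean_space \<Rightarrow> real" and G :: "'a \<Rightarrow> 'a"
  assumes r: "C1 r" "\<And>x. 0 < r x" "integrable lborel r"
    and G: "C1 G" "integrable lborel (\<lambda>x. r x * (norm (G x))\<^sup>2)"
    and u: "C1 u" "integrable lborel (\<lambda>x. r x * (norm (grad u x))\<^sup>2)"
    and "integrable lborel (\<lambda>x. u x * divergence (\<lambda>x. r x *\<^sub>R G x) x)"
  shows "(\<integral>x. u x * divergence (\<lambda>x. r x *\<^sub>R G x) x \<partial>lborel) = - (\<integral>x. r x * (grad u x \<bullet> G x) \<partial>lborel)"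
proof -
  note [measurable] = C1_borel_measurable[OF r(1)] C1_borel_measurable[OF G(1)] C1_borel_measurable_grad[OF u(1)]
  have "integrable lborel (\<lambda>x. r x *\<^sub>R G x)"
  proof (rule Bochner_Integration.integrable_bound)
    show "integrable lborel (\<lambda>x. r x + r x * (norm (G x))\<^sup>2)"
      using r G by simp
    show "AE x in lborel. norm (r x *\<^sub>R G x) \<le> norm (r x + r x * (norm (G x))\<^sup>2)"
    proof (rule AE_I2)
      fix x
      have "norm (G x) \<le> 1 + (norm (G x))\<^sup>2"
        using sum_squares_bound[of 1 "norm (G x)"] norm_ge_zero[of "G x"] unfolding one_power2 by linarith
      then have "r x * norm (G x) \<le> r x * (1 + (norm (G x))\<^sup>2)"
        using r(2)[of x] by (intro mult_left_mono) auto
      then show "norm (r x *\<^sub>R G x) \<le> norm (r x + r x * (norm (G x))\<^sup>2)"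
        using r(2)[of x] by (simp add: distrib_left)
    qed
  qed simp
  moreover have "integrable lborel (\<lambda>x. r x * (grad u x \<bullet> G x))"
    using r(2) G(2) u(2) by (intro integrable_weighted_inner) (auto intro: less_imp_le)
  ultimately show ?thesis
    using integration_by_parts_divergence[OF u(1) C1_scaleR[OF r(1) G(1)]] assms(8) by simp
qed

text \<open>Uniqueness of the Wasserstein score: the potential itself is an admissible test function.\<close>

lemma weighted_solenoidal_gradient_eq_0:
  fixes r w :: "'a::euclidean_space \<Rightarrow> real"
  assumes r: "C1 r" "\<And>x. 0 < r x" "integrable lborel r"
    and w: "\<And>x. w differentiable at x" "C1 (grad w)" "integrable lborel (\<lambda>x. r x * (norm (grad w x))\<^sup>2)"
    and div: "\<And>x. divergence (\<lambda>x. r x *\<^sub>R grad w x) x = 0"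
  shows "grad w x = 0"
proof -
  have "C1 w"
    using w C1_continuous_on C1_iff_continuous_grad by blast
  \<comment> \<open>The test function is \<open>w\<close> itself. Its product with the divergence is
    identically zero, hence trivially integrable, and the remaining side is the weighted square norm
    of \<open>grad w\<close>.\<close>
  then have "(\<integral>x. r x * (norm (grad w x))\<^sup>2 \<partial>lborel) = 0"
    using weighted_integration_by_parts[OF r w(2,3) _ w(3)] div by (simp add: power2_norm_eq_inner)
  moreover have "continuous_on UNIV (\<lambda>x. r x * (norm (grad w x))\<^sup>2)"
    using C1_continuous_on[OF r(1)] C1_continuous_on[OF w(2)] by (intro continuous_intros)
  moreover have "0 \<le> r x * (norm (grad w x))\<^sup>2" for x
    using r(2)[of x] by simp
  ultimately have "r x * (norm (grad w x))\<^sup>2 = 0"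
    using continuous_integral_eq_0_imp_0[of "\<lambda>x. r x * (norm (grad w x))\<^sup>2"] w(3) by blast
  then show ?thesis
    using r(2)[of x] by simp
qed

section \<open>Models and estimators expressed through Lebesgue measure\<close>

lemma law_integrable_iff:
  assumes "C1 (p \<theta>)" "\<And>x. 0 < p \<theta> x" "f \<in> borel_measurable borel"
  shows "integrable (law p \<theta>) f \<longleftrightarrow> integrable lborel (\<lambda>x. p \<theta> x * f x)"
  unfolding law_def using assms C1_borel_measurable[of "p \<theta>"]
  by (subst integrable_density) (auto intro: less_imp_le)

lemma expect_eq_lborel:
  assumes "C1 (p \<theta>)" "\<And>x. 0 < p \<theta> x" "f \<in> borel_measurable borel"
  shows "expect p \<theta> f = (\<integral>x. p \<theta> x * f x \<partial>lborel)"
  unfolding expect_def law_def using assms C1_borel_measurable[of "p \<theta>"]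
  by (subst integral_density) (auto intro: less_imp_le)

lemma density_modelD:
  assumes "density_model \<Theta> p" "\<theta> \<in> \<Theta>"
  shows "C1 (p \<theta>)" "0 < p \<theta> x" "integrable lborel (p \<theta>)" "prob_space (law p \<theta>)"
    "((\<lambda>t. p t x) has_real_derivative deriv (\<lambda>t. p t x) \<theta>) (at \<theta>)"
proof -
  have p: "C1 (p \<theta>)" "\<And>x. 0 < p \<theta> x" "prob_space (law p \<theta>)"
    using assms unfolding density_model_def by auto
  then show "C1 (p \<theta>)" "0 < p \<theta> x" "prob_space (law p \<theta>)"
    by auto
  \<comment> \<open>The constant 1 is integrable under a probability measure; transferred to
    \<open>lborel\<close>, this is integrability of the density.\<close>
  have "integrable (law p \<theta>) (\<lambda>x. 1 :: real)"
    using p(3) by (simp add: prob_space.finite_measure finite_measure.integrable_const)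
  then show "integrable lborel (p \<theta>)"
    using p by (subst (asm) law_integrable_iff) auto
  have "(\<lambda>t. p t x) differentiable at \<theta>"
    using assms unfolding density_model_def differentiable_on_def
    by (metis at_within_open)
  then show "((\<lambda>t. p t x) has_real_derivative deriv (\<lambda>t. p t x) \<theta>) (at \<theta>)"
    using DERIV_deriv_iff_real_differentiable by blast
qed

lemma regular_modelD:
  assumes "regular_model \<Theta> p \<Phi>" "\<theta> \<in> \<Theta>"
  shows "density_model \<Theta> p" "\<Phi> \<theta> differentiable at x" "C1 (grad (\<Phi> \<theta>))" "C1 (\<Phi> \<theta>)"
    "deriv (\<lambda>t. p t x) \<theta> = - divergence (\<lambda>y. p \<theta> y *\<^sub>R grad (\<Phi> \<theta>) y) x"
    "integrable (law p \<theta>) (\<Phi> \<theta>)" "expect p \<theta> (\<Phi> \<theta>) = 0"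
    "integrable lborel (\<lambda>x. p \<theta> x * (norm (grad (\<Phi> \<theta>) x))\<^sup>2)"
    "wasserstein_information p \<Phi> \<theta> = (\<integral>x. p \<theta> x * (norm (grad (\<Phi> \<theta>) x))\<^sup>2 \<partial>lborel)"
    "0 < wasserstein_information p \<Phi> \<theta>"
proof -
  show dm: "density_model \<Theta> p" and "\<Phi> \<theta> differentiable at x" and C: "C1 (grad (\<Phi> \<theta>))"
    "integrable (law p \<theta>) (\<Phi> \<theta>)" "expect p \<theta> (\<Phi> \<theta>) = 0"
    "0 < wasserstein_information p \<Phi> \<theta>"
    using assms unfolding regular_model_def wasserstein_score_def by auto
  have "\<And>x. \<Phi> \<theta> differentiable at x"
    using assms unfolding regular_model_def wasserstein_score_def by auto
  then show "C1 (\<Phi> \<theta>)"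
    using C C1_continuous_on C1_iff_continuous_grad by blast
  have "deriv (\<lambda>t. p t x) \<theta> + divergence (\<lambda>y. p \<theta> y *\<^sub>R grad (\<Phi> \<theta>) y) x = 0"
    using assms unfolding regular_model_def wasserstein_score_def by auto
  then show "deriv (\<lambda>t. p t x) \<theta> = - divergence (\<lambda>y. p \<theta> y *\<^sub>R grad (\<Phi> \<theta>) y) x"
    by simp
  note [measurable] = C1_borel_measurable[OF C(1)]
  note p = density_modelD[OF dm assms(2)]
  have "integrable (law p \<theta>) (\<lambda>x. (norm (grad (\<Phi> \<theta>) x))\<^sup>2)"
    using assms unfolding regular_model_def by auto
  then show "integrable lborel (\<lambda>x. p \<theta> x * (norm (grad (\<Phi> \<theta>) x))\<^sup>2)"
    by (subst (asm) law_integrable_iff) (use p in auto)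
  show "wasserstein_information p \<Phi> \<theta> = (\<integral>x. p \<theta> x * (norm (grad (\<Phi> \<theta>) x))\<^sup>2 \<partial>lborel)"
    unfolding wasserstein_information_def by (subst expect_eq_lborel) (use p in auto)
qed

lemma regular_estimatorD:
  assumes "density_model \<Theta> p" "regular_estimator \<Theta> p a" "\<theta> \<in> \<Theta>"
  shows "C1 a" "integrable (law p \<theta>) a" "integrable lborel (\<lambda>x. p \<theta> x * a x)"
    "integrable lborel (\<lambda>x. p \<theta> x * (norm (grad a x))\<^sup>2)"
    "wasserstein_variance p \<theta> a = (\<integral>x. p \<theta> x * (norm (grad a x))\<^sup>2 \<partial>lborel)"
    "expect p \<theta> a = (\<integral>x. p \<theta> x * a x \<partial>lborel)"
proof -
  show a: "C1 a" "integrable (law p \<theta>) a"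
    using assms unfolding regular_estimator_def by auto
  note [measurable] = C1_borel_measurable[OF a(1)] C1_borel_measurable_grad[OF a(1)]
  note p = density_modelD[OF assms(1,3)]
  show "integrable lborel (\<lambda>x. p \<theta> x * a x)"
    using a(2) by (subst (asm) law_integrable_iff) (use p in auto)
  have "integrable (law p \<theta>) (\<lambda>x. (norm (grad a x))\<^sup>2)"
    using assms unfolding regular_estimator_def by auto
  then show "integrable lborel (\<lambda>x. p \<theta> x * (norm (grad a x))\<^sup>2)"
    by (subst (asm) law_integrable_iff) (use p in auto)
  show "wasserstein_variance p \<theta> a = (\<integral>x. p \<theta> x * (norm (grad a x))\<^sup>2 \<partial>lborel)"
    unfolding wasserstein_variance_def by (subst expect_eq_lborel) (use p in auto)
  show "expect p \<theta> a = (\<integral>x. p \<theta> x * a x \<partial>lborel)"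
    by (subst expect_eq_lborel) (use p in auto)
qed

section \<open>The derivative of the mean and the equality case of the bound\<close>

lemma has_real_derivative_expect:
  fixes p \<Phi> :: "real \<Rightarrow> 'a::euclidean_space \<Rightarrow> real"
  assumes m: "regular_model \<Theta> p \<Phi>" and e: "regular_estimator \<Theta> p a" and \<theta>: "\<theta> \<in> \<Theta>"
  shows "((\<lambda>t. expect p t a) has_real_derivative
    (\<integral>x. p \<theta> x * (grad a x \<bullet> grad (\<Phi> \<theta>) x) \<partial>lborel)) (at \<theta>)"
proof -
  note \<Phi> = regular_modelD[OF m \<theta>]
  note p = density_modelD[OF \<Phi>(1) \<theta>]
  note a = regular_estimatorD[OF \<Phi>(1) e]
  have op: "open \<Theta>"
    using \<Phi>(1) by (simp add: density_model_def)
  note [measurable] = C1_borel_measurable[OF a(1)[OF \<theta>]]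
    C1_borel_measurable_divergence[OF C1_scaleR[OF p(1) \<Phi>(3)]]
  define f' where "f' t x = a x * deriv (\<lambda>t. p t x) t" for t x
  \<comment> \<open>The continuity equation exhibits the parameter derivative as minus the
    divergence of a \<open>C1\<close> field, which supplies its measurability in
    \<open>x\<close>.\<close>
  have f'_eq: "f' \<theta> = (\<lambda>x. - (a x * divergence (\<lambda>y. p \<theta> y *\<^sub>R grad (\<Phi> \<theta>) y) x))"
    by (simp add: f'_def[abs_def] \<Phi>(5))
  have meas: "f' \<theta> \<in> borel_measurable lborel"
    unfolding f'_eq by measurable
  obtain \<epsilon> g where g: "0 < \<epsilon>" "integrable lborel g"
    "\<And>t x. t \<in> \<Theta> \<Longrightarrow> \<bar>t - \<theta>\<bar> < \<epsilon> \<Longrightarrow> \<bar>f' t x\<bar> \<le> g x"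
    using e \<theta> unfolding regular_estimator_def f'_def by metis
  have D: "((\<lambda>t. \<integral>x. p t x * a x \<partial>lborel) has_real_derivative (\<integral>x. f' \<theta> x \<partial>lborel)) (at \<theta>)"
  proof (rule has_real_derivative_integral_parametric[where f' = f', OF op \<theta> _ meas _ g])
    show "((\<lambda>t. p t x * a x) has_real_derivative f' t x) (at t)" if "t \<in> \<Theta>" for t x
      unfolding f'_def using density_modelD(5)[OF \<Phi>(1) that, of x]
      by (auto intro!: derivative_eq_intros)
  qed (use a(3) in auto)
  \<comment> \<open>The local domination, read at \<theta> itself, also provides the integrability
    that integration by parts requires.\<close>
  have "integrable lborel (f' \<theta>)"
    using g(3)[OF \<theta>] g(1)
    by (intro Bochner_Integration.integrable_bound[OF g(2) meas] AE_I2)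
      (auto intro: order_trans[OF _ abs_ge_self])
  then have int: "integrable lborel (\<lambda>x. a x * divergence (\<lambda>y. p \<theta> y *\<^sub>R grad (\<Phi> \<theta>) y) x)"
    unfolding f'_eq by simp
  have "(\<integral>x. f' \<theta> x \<partial>lborel) = (\<integral>x. p \<theta> x * (grad a x \<bullet> grad (\<Phi> \<theta>) x) \<partial>lborel)"
    unfolding f'_eq using weighted_integration_by_parts[OF p(1-3) \<Phi>(3,8) a(1,4)[OF \<theta>] int] by simp
  moreover have "((\<lambda>t. expect p t a) has_real_derivative (\<integral>x. f' \<theta> x \<partial>lborel)) (at \<theta>)"
    by (rule has_field_derivative_transform_within_open[OF D op \<theta>]) (simp add: a(6))
  ultimately show ?thesis
    by simp
qed

text \<open>This is the quadratic polynomial in \<mu> behind the proof of Cauchy--Schwarz. Its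
  integrability part also shows that differences of score gradients are square-integrable.\<close>

lemma weighted_norm_diff_expansion:
  fixes U V :: "'a::euclidean_space \<Rightarrow> 'a" and r :: "'a \<Rightarrow> real"
  assumes "U \<in> borel_measurable borel" "V \<in> borel_measurable borel" "r \<in> borel_measurable borel"
    and "\<And>x. 0 \<le> r x" and int: "integrable lborel (\<lambda>x. r x * (norm (U x))\<^sup>2)"
    "integrable lborel (\<lambda>x. r x * (norm (V x))\<^sup>2)"
  shows "integrable lborel (\<lambda>x. r x * (norm (U x - \<mu> *\<^sub>R V x))\<^sup>2)"
    "(\<integral>x. r x * (norm (U x - \<mu> *\<^sub>R V x))\<^sup>2 \<partial>lborel) = (\<integral>x. r x * (norm (U x))\<^sup>2 \<partial>lborel)
      - 2 * \<mu> * (\<integral>x. r x * (U x \<bullet> V x) \<partial>lborel) + \<mu>\<^sup>2 * (\<integral>x. r x * (norm (V x))\<^sup>2 \<partial>lborel)"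
proof -
  have eq: "r x * (norm (U x - \<mu> *\<^sub>R V x))\<^sup>2
      = r x * (norm (U x))\<^sup>2 - 2 * \<mu> * (r x * (U x \<bullet> V x)) + \<mu>\<^sup>2 * (r x * (norm (V x))\<^sup>2)" for x
    unfolding power2_norm_eq_inner
    by (simp add: inner_diff_left inner_diff_right inner_commute[of "V x" "U x"]
        power2_eq_square[of \<mu>] algebra_simps)
  note i = integrable_weighted_inner[OF assms]
  show "integrable lborel (\<lambda>x. r x * (norm (U x - \<mu> *\<^sub>R V x))\<^sup>2)"
    unfolding eq using int i by (intro Bochner_Integration.integrable_add Bochner_Integration.integrable_diff integrable_mult_right)
  show "(\<integral>x. r x * (norm (U x - \<mu> *\<^sub>R V x))\<^sup>2 \<partial>lborel) = (\<integral>x. r x * (norm (U x))\<^sup>2 \<partial>lborel)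
      - 2 * \<mu> * (\<integral>x. r x * (U x \<bullet> V x) \<partial>lborel) + \<mu>\<^sup>2 * (\<integral>x. r x * (norm (V x))\<^sup>2 \<partial>lborel)"
    unfolding eq using int i by simp
qed

text \<open>The multiplier stands on the score side because positive information makes that gradient
  nonzero in the weighted norm, so projecting onto it is always possible.\<close>

lemma WCR_equality_iff_proportional_gradients:
  fixes p \<Phi> :: "real \<Rightarrow> 'a::euclidean_space \<Rightarrow> real"
  assumes m: "regular_model \<Theta> p \<Phi>" and e: "regular_estimator \<Theta> p a" and \<theta>: "\<theta> \<in> \<Theta>"
  shows "wasserstein_variance p \<theta> a = 1 / wasserstein_information p \<Phi> \<theta> * (deriv (\<lambda>t. expect p t a) \<theta>)\<^sup>2
    \<longleftrightarrow> (\<exists>\<mu>. \<forall>x. grad a x = \<mu> *\<^sub>R grad (\<Phi> \<theta>) x)"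
proof -
  note \<Phi> = regular_modelD[OF m \<theta>]
  note p = density_modelD[OF \<Phi>(1) \<theta>]
  note a = regular_estimatorD[OF \<Phi>(1) e \<theta>]
  define V where "V = (\<integral>x. p \<theta> x * (norm (grad a x))\<^sup>2 \<partial>lborel)"
  define I where "I = (\<integral>x. p \<theta> x * (grad a x \<bullet> grad (\<Phi> \<theta>) x) \<partial>lborel)"
  define G where "G = (\<integral>x. p \<theta> x * (norm (grad (\<Phi> \<theta>) x))\<^sup>2 \<partial>lborel)"
  have G: "0 < G"
    using \<Phi>(9,10) by (simp add: G_def)
  have dI: "deriv (\<lambda>t. expect p t a) \<theta> = I"
    unfolding I_def by (rule DERIV_imp_deriv[OF has_real_derivative_expect[OF m e \<theta>]])
  have "V = 1 / G * I\<^sup>2 \<longleftrightarrow> (\<exists>\<mu>. \<forall>x. grad a x = \<mu> *\<^sub>R grad (\<Phi> \<theta>) x)"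
  proof
    assume eq: "V = 1 / G * I\<^sup>2"
    \<comment> \<open>The coefficient of the projection of \<open>grad a\<close> onto the score
      gradient. For it the quadratic equals \<open>V - I\<^sup>2 / G\<close>, exactly the defect of
      the bound.\<close>
    define \<mu> where "\<mu> = I / G"
    define f where "f x = p \<theta> x * (norm (grad a x - \<mu> *\<^sub>R grad (\<Phi> \<theta>) x))\<^sup>2" for x
    have f0: "0 \<le> f x" for x
      using p(2)[of x] by (simp add: f_def)
    note exp = weighted_norm_diff_expansion[OF C1_borel_measurable_grad[OF a(1)] C1_borel_measurable[OF \<Phi>(3)]
        C1_borel_measurable[OF p(1)] less_imp_le[OF p(2)] a(4) \<Phi>(8), of \<mu>]
    have "(\<integral>x. f x \<partial>lborel) = V - 2 * \<mu> * I + \<mu>\<^sup>2 * G"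
      unfolding f_def V_def I_def G_def by (rule exp(2))
    also have "\<dots> = 0"
      using G unfolding eq \<mu>_def by (simp add: power2_eq_square field_simps)
    finally have "(\<integral>x. f x \<partial>lborel) = 0" .
    moreover have "integrable lborel f"
      unfolding f_def by (rule exp(1))
    moreover have "continuous_on UNIV f"
      unfolding f_def using C1_continuous_on[OF p(1)] C1_continuous_grad[OF a(1)] C1_continuous_on[OF \<Phi>(3)]
      by (intro continuous_intros)
    ultimately have "f x = 0" for x
      using continuous_integral_eq_0_imp_0[of f x] f0 by blast
    then have "grad a x = \<mu> *\<^sub>R grad (\<Phi> \<theta>) x" for x
      using p(2)[of x] unfolding f_def by (metis eq_iff_diff_eq_0 less_irrefl mult_eq_0_iff norm_eq_zero zero_eq_power2)
    then show "\<exists>\<mu>. \<forall>x. grad a x = \<mu> *\<^sub>R grad (\<Phi> \<theta>) x"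
      by blast
  next
    assume "\<exists>\<mu>. \<forall>x. grad a x = \<mu> *\<^sub>R grad (\<Phi> \<theta>) x"
    then obtain \<mu> where \<mu>: "\<And>x. grad a x = \<mu> *\<^sub>R grad (\<Phi> \<theta>) x"
      by blast
    have "V = \<mu>\<^sup>2 * G"
      unfolding V_def G_def \<mu> by (simp add: power_mult_distrib mult.left_commute[of _ "\<mu>\<^sup>2"])
    moreover have "I = \<mu> * G"
      unfolding I_def G_def \<mu> by (simp add: power2_norm_eq_inner mult.left_commute[of _ \<mu>])
    ultimately show "V = 1 / G * I\<^sup>2"
      using G by (simp add: power2_eq_square)
  qed
  then show ?thesis
    by (simp only: a(5) \<Phi>(9) dI V_def G_def)
qed

section \<open>One-variable calculus for reparametrizations\<close>

text \<open>An arbitrary monotone reparametrization may have jumps, but its inverse cannot: the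
  inverse is monotone and its image is the open set \<open>S\<close>. The decreasing case follows by
  negating the inverse.\<close>

lemma continuous_on_inv_into_strict_mono_on:
  fixes h :: "real \<Rightarrow> real"
  assumes "open S" and mono: "strict_mono_on S h \<or> strict_antimono_on S h"
  shows "inj_on h S" "continuous_on (h ` S) (inv_into S h)"
proof -
  show inj: "inj_on h S"
    using mono
  proof
    assume "strict_mono_on S h"
    then show ?thesis by (rule strict_mono_on_imp_inj_on)
  next
    assume "strict_antimono_on S h"
    then show ?thesis
      by (auto simp: monotone_on_def inj_on_def) (metis less_irrefl linorder_neqE)
  qed
  have im: "inv_into S h ` h ` S = S"
    using inj by (simp add: inv_into_image_cancel)
  show "continuous_on (h ` S) (inv_into S h)"
    using mono
  proof
    assume h: "strict_mono_on S h"
    have "inv_into S h x \<le> inv_into S h y" if "x \<in> h ` S" "y \<in> h ` S" "x \<le> y" for x y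
      using that inj h by (auto simp: monotone_on_def) (meson linorder_not_le)
    then show ?thesis
      using assms(1) im by (intro continuous_onI_mono) auto
  next
    assume h: "strict_antimono_on S h"
    have "- inv_into S h x \<le> - inv_into S h y" if "x \<in> h ` S" "y \<in> h ` S" "x \<le> y" for x y
      using that inj h by (auto simp: monotone_on_def) (meson linorder_not_le)
    moreover have "(\<lambda>t. - inv_into S h t) ` h ` S = uminus ` S"
      using im by (metis image_image)
    ultimately have "continuous_on (h ` S) (\<lambda>t. - inv_into S h t)"
      using open_negations[OF assms(1)] by (intro continuous_onI_mono) auto
    from continuous_on_minus[OF this] show ?thesis
      by simp
  qed
qed

text \<open>The chain rule solved for the inner derivative. Caratheodory's slope function
  \<open>g\<close> is continuous and nonzero at \<open>k t\<close>, so dividing by it avoids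
  dividing by increments of \<open>k\<close>, which might vanish.\<close>

lemma has_real_derivative_inner_function:
  fixes f k :: "real \<Rightarrow> real"
  assumes f: "(f has_real_derivative d) (at (k t))" "d \<noteq> 0"
    and fk: "((\<lambda>s. f (k s)) has_real_derivative e) (at t)" and k: "isCont k t"
  shows "(k has_real_derivative e / d) (at t)"
proof -
  obtain g where g: "\<And>z. f z - f (k t) = g z * (z - k t)" "isCont g (k t)" "g (k t) = d"
    using f(1) unfolding DERIV_caratheodory_within continuous_within by (auto simp: isCont_def)
  have lim: "((\<lambda>s. g (k s)) \<longlongrightarrow> d) (at t)"
    using isCont_o2[OF k g(2)] g(3) by (simp add: isCont_def)
  then have nz: "\<forall>\<^sub>F s in at t. g (k s) \<noteq> 0"
    using f(2) by (rule tendsto_imp_eventually_ne)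
  have "((\<lambda>s. (f (k s) - f (k t)) / (s - t) / g (k s)) \<longlongrightarrow> e / d) (at t)"
    using fk lim f(2) by (intro tendsto_divide) (auto simp: has_field_derivative_iff)
  moreover have "\<forall>\<^sub>F s in at t. (f (k s) - f (k t)) / (s - t) / g (k s) = (k s - k t) / (s - t)"
    using nz by eventually_elim (simp add: g(1))
  ultimately show ?thesis
    unfolding has_field_derivative_iff by (rule Lim_transform_eventually)
qed

lemma antiderivative_on_open_interval:
  fixes f :: "real \<Rightarrow> real"
  assumes S: "open S" "is_interval S" and f: "continuous_on S f"
  obtains F where "\<And>x. x \<in> S \<Longrightarrow> (F has_real_derivative f x) (at x)"
proof (cases "S = {}")
  case False
  then obtain c where c: "c \<in> S" by blast
  have "((\<lambda>u. LBINT y=c..u. f y) has_real_derivative f x) (at x)" if x: "x \<in> S" for x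
  proof -
    obtain e where e: "0 < e" "cball x e \<subseteq> S"
      using S(1) x open_contains_cball by blast
    \<comment> \<open>The compact interval from \<open>l\<close> to \<open>u\<close> contains the
      base point \<open>c\<close> and has \<open>x\<close> in its interior, so the derivative within
      it given by the fundamental theorem is a full derivative.\<close>
    define l where "l = min c (x - e)"
    define u where "u = max c (x + e)"
    have "x - e \<in> S" "x + e \<in> S"
      using e by (auto simp: subset_iff dist_real_def)
    then have "l \<in> S" "u \<in> S"
      using c by (auto simp: l_def u_def min_def max_def)
    then have "{l..u} \<subseteq> S"
      using mem_is_interval_1_I[OF S(2)] by (meson atLeastAtMost_iff subsetI)
    then have cont: "continuous_on {l..u} f"
      using f continuous_on_subset by blast
    have lu: "l \<le> c" "c \<le> u" "l < x" "x < u"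
      using e by (auto simp: l_def u_def)
    then have "((\<lambda>u. LBINT y=c..u. f y) has_vector_derivative f x) (at x within {l..u})"
      using interval_integral_FTC2[OF lu(1,2) cont, of x] by simp
    then show ?thesis
      using lu by (simp add: has_real_derivative_iff_has_vector_derivative at_within_Icc_at)
  qed
  then show ?thesis
    using that by blast
qed (use that in auto)

text \<open>By connectedness the image of \<open>k\<close> is an interval that misses 0, so the
  derivative has constant sign.\<close>

lemma strict_mono_on_of_deriv_nonzero:
  fixes h :: "real \<Rightarrow> real"
  assumes S: "is_interval S" and h: "\<And>x. x \<in> S \<Longrightarrow> (h has_real_derivative k x) (at x)"
    and k: "continuous_on S k" "\<And>x. x \<in> S \<Longrightarrow> k x \<noteq> 0"
  shows "strict_mono_on S h \<or> strict_antimono_on S h"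
proof -
  have "is_interval (k ` S)"
    using S k(1) by (simp add: is_interval_connected_1 connected_continuous_image)
  moreover have "0 \<notin> k ` S"
    using k(2) by force
  ultimately have sgn: "(\<forall>x\<in>S. 0 < k x) \<or> (\<forall>x\<in>S. k x < 0)"
    unfolding is_interval_1 by (metis imageI linorder_not_le)
  have seg: "z \<in> S" if "x \<in> S" "y \<in> S" "x \<le> z" "z \<le> y" for x y z
    using S that unfolding is_interval_1 by blast
  from sgn show ?thesis
  proof
    assume pos: "\<forall>x\<in>S. 0 < k x"
    have "h x < h y" if "x \<in> S" "y \<in> S" "x < y" for x y
      using that h pos seg by (intro DERIV_pos_imp_increasing[OF \<open>x < y\<close>]) blast
    then show ?thesis
      by (auto simp: monotone_on_def)
  next
    assume neg: "\<forall>x\<in>S. k x < 0"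
    have "h y < h x" if "x \<in> S" "y \<in> S" "x < y" for x y
      using that h neg seg by (intro DERIV_neg_imp_decreasing[OF \<open>x < y\<close>]) blast
    then show ?thesis
      by (auto simp: monotone_on_def)
  qed
qed

section \<open>The two implications between geodesics and proportional gradients\<close>

lemma e_geodesic_imp_proportional_gradients:
  fixes p \<Phi> :: "real \<Rightarrow> 'a::euclidean_space \<Rightarrow> real"
  assumes m: "regular_model \<Theta> p \<Phi>" and \<theta>: "\<theta> \<in> \<Theta>"
    and h: "strict_mono_on \<Theta> h \<or> strict_antimono_on \<Theta> h"
    and m': "regular_model (h ` \<Theta>) (reparametrize \<Theta> h p) \<Psi>"
    and aff: "affine_in_score (h ` \<Theta>) \<Psi> a"
  shows "\<exists>\<mu>. \<forall>x. grad a x = \<mu> *\<^sub>R grad (\<Phi> \<theta>) x"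
proof -
  define k where "k = inv_into \<Theta> h"
  define q where "q = reparametrize \<Theta> h p"
  define t where "t = h \<theta>"
  have t: "t \<in> h ` \<Theta>"
    using \<theta> by (simp add: t_def)
  note \<Phi> = regular_modelD[OF m \<theta>]
  note \<Psi> = regular_modelD[OF m' t, folded q_def]
  note p = density_modelD[OF \<Phi>(1) \<theta>]
  note q = density_modelD[OF \<Psi>(1) t]
  have op: "open \<Theta>" "open (h ` \<Theta>)"
    using \<Phi>(1) \<Psi>(1) by (auto simp: density_model_def)
  note inj = continuous_on_inv_into_strict_mono_on[OF op(1) h]
  have kt: "k t = \<theta>"
    using inj(1) \<theta> by (simp add: k_def t_def)
  have qp: "q s x = p (k s) x" for s x
    by (simp add: q_def k_def reparametrize_def)
  have qt: "q t = p \<theta>"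
    by (simp add: fun_eq_iff qp kt)
  have "isCont k t"
    using inj(2) op(2) t continuous_on_eq_continuous_at unfolding k_def by blast
  \<comment> \<open>Otherwise \<Phi> would satisfy the homogeneous continuity equation, and
    uniqueness would force its gradient, and hence the information, to vanish.\<close>
  have "\<exists>x. deriv (\<lambda>s. p s x) \<theta> \<noteq> 0"
  proof (rule ccontr)
    assume "\<nexists>x. deriv (\<lambda>s. p s x) \<theta> \<noteq> 0"
    then have "divergence (\<lambda>y. p \<theta> y *\<^sub>R grad (\<Phi> \<theta>) y) x = 0" for x
      using \<Phi>(5)[of x] by simp
    then have "grad (\<Phi> \<theta>) x = 0" for x
      using weighted_solenoidal_gradient_eq_0[OF p(1-3) \<Phi>(2,3,8)] by blast
    then show False
      using \<Phi>(9,10) by simp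
  qed
  then obtain x0 where x0: "deriv (\<lambda>s. p s x0) \<theta> \<noteq> 0" by blast
  \<comment> \<open>Since \<open>q s x0 = p (k s) x0\<close>, comparing the two parameter
    derivatives at \<open>x0\<close> yields differentiability of the inverse \<open>k\<close>,
    although \<open>h\<close> is only known to be monotone.\<close>
  define \<kappa> where "\<kappa> = deriv (\<lambda>s. q s x0) t / deriv (\<lambda>s. p s x0) \<theta>"
  have k': "(k has_real_derivative \<kappa>) (at t)"
    unfolding \<kappa>_def
    by (rule has_real_derivative_inner_function[where f = "\<lambda>s. p s x0"])
      (use p(5)[of x0] q(5)[of x0] x0 \<open>isCont k t\<close> in \<open>simp_all add: kt qp\<close>)
  have chain: "deriv (\<lambda>s. q s x) t = deriv (\<lambda>s. p s x) \<theta> * \<kappa>" for x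
    using DERIV_chain2[OF p(5)[of x, folded kt] k'] unfolding qp kt by (rule DERIV_imp_deriv)
  \<comment> \<open>By the chain rule the parameter derivatives cancel in this combination, so
    \<open>w\<close> solves the homogeneous continuity equation for the common density
    \<open>p \<theta>\<close>.\<close>
  define w where "w x = \<Psi> t x - \<kappa> * \<Phi> \<theta> x" for x
  have gw: "GDERIV w x :> grad (\<Psi> t) x - \<kappa> *\<^sub>R grad (\<Phi> \<theta>) x" for x
    using gderiv_grad[OF \<Psi>(2)[of x]] gderiv_grad[OF \<Phi>(2)[of x]]
    unfolding w_def gderiv_def inner_diff_right inner_scaleR_right
    by (intro has_derivative_diff has_derivative_mult_right)
  have grad_w: "grad w x = grad (\<Psi> t) x - \<kappa> *\<^sub>R grad (\<Phi> \<theta>) x" for x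
    by (rule grad_eqI[OF gw])
  have "grad w x = 0" for x
  proof (rule weighted_solenoidal_gradient_eq_0[OF p(1-3)])
    show "w differentiable at x" for x
      using gw[of x] unfolding gderiv_def differentiable_def by blast
    have "grad w = (\<lambda>x. 1 *\<^sub>R grad (\<Psi> t) x + (- \<kappa>) *\<^sub>R grad (\<Phi> \<theta>) x)"
      by (simp add: fun_eq_iff grad_w)
    then show "C1 (grad w)"
      using C1_lincomb[OF \<Psi>(3) \<Phi>(3), of 1 "- \<kappa>"] by simp
    show "integrable lborel (\<lambda>x. p \<theta> x * (norm (grad w x))\<^sup>2)"
      unfolding grad_w using C1_borel_measurable[OF \<Psi>(3)] C1_borel_measurable[OF \<Phi>(3)]
        C1_borel_measurable[OF p(1)] less_imp_le[OF p(2)] \<Psi>(8)[unfolded qt] \<Phi>(8)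
      by (rule weighted_norm_diff_expansion)
    fix x
    have d: "(\<lambda>x. p \<theta> x *\<^sub>R grad (\<Psi> t) x) differentiable at x"
      "(\<lambda>x. p \<theta> x *\<^sub>R grad (\<Phi> \<theta>) x) differentiable at x"
      using C1_scaleR[OF p(1) \<Psi>(3)] C1_scaleR[OF p(1) \<Phi>(3)] by (simp_all add: C1_def)
    have "(\<lambda>x. p \<theta> x *\<^sub>R grad w x)
        = (\<lambda>x. 1 *\<^sub>R (p \<theta> x *\<^sub>R grad (\<Psi> t) x) + (- \<kappa>) *\<^sub>R (p \<theta> x *\<^sub>R grad (\<Phi> \<theta>) x))"
      by (simp add: fun_eq_iff grad_w scaleR_diff_right mult.commute)
    then show "divergence (\<lambda>x. p \<theta> x *\<^sub>R grad w x) x = 0"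
      using divergence_lincomb[OF d, of 1 "- \<kappa>"] \<Psi>(5)[of x] \<Phi>(5)[of x] chain[of x]
      by (simp add: qt mult.commute)
  qed
  then have \<Psi>\<Phi>: "grad (\<Psi> t) x = \<kappa> *\<^sub>R grad (\<Phi> \<theta>) x" for x
    by (simp add: grad_w)
  obtain \<alpha> \<beta> where ab: "\<And>x. a x = \<alpha> * \<Psi> t x + \<beta> t"
    using aff t unfolding affine_in_score_def by blast
  have "grad a x = (\<alpha> * \<kappa>) *\<^sub>R grad (\<Phi> \<theta>) x" for x
  proof (rule grad_eqI)
    have "GDERIV (\<lambda>x. \<alpha> * \<Psi> t x + \<beta> t) x :> \<alpha> *\<^sub>R grad (\<Psi> t) x + 0"
      using gderiv_grad[OF \<Psi>(2)[of x]] GDERIV_const[of "\<beta> t" x]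
      unfolding gderiv_def inner_add_right inner_scaleR_right
      by (intro has_derivative_add has_derivative_mult_right)
    moreover have "a = (\<lambda>x. \<alpha> * \<Psi> t x + \<beta> t)"
      using ab by blast
    ultimately show "GDERIV a x :> (\<alpha> * \<kappa>) *\<^sub>R grad (\<Phi> \<theta>) x"
      by (simp add: \<Psi>\<Phi>)
  qed
  then show ?thesis
    by blast
qed

lemma proportional_gradients_imp_e_geodesic:
  fixes p \<Phi> :: "real \<Rightarrow> 'a::euclidean_space \<Rightarrow> real"
  assumes m: "regular_model \<Theta> p \<Phi>" and e: "regular_estimator \<Theta> p a"
    and nonconst: "\<not> a constant_on UNIV"
    and grads: "\<And>\<theta>. \<theta> \<in> \<Theta> \<Longrightarrow> \<exists>\<mu>. \<forall>x. grad a x = \<mu> *\<^sub>R grad (\<Phi> \<theta>) x"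
  shows "\<exists>h \<Psi>. (strict_mono_on \<Theta> h \<or> strict_antimono_on \<Theta> h) \<and>
       e_geodesic (h ` \<Theta>) (reparametrize \<Theta> h p) \<Psi> \<and> affine_in_score (h ` \<Theta>) \<Psi> a"
proof -
  have dm: "density_model \<Theta> p"
    using m by (simp add: regular_model_def)
  then have \<Theta>: "open \<Theta>" "is_interval \<Theta>" "\<Theta> \<noteq> {}"
    by (auto simp: density_model_def)
  have a: "C1 a"
    using e by (simp add: regular_estimator_def)
  have ga: "GDERIV a x :> grad a x" for x
    using a gderiv_grad by (auto simp: C1_def)
  obtain x0 x1 where x01: "a x0 \<noteq> a x1"
    using nonconst unfolding constant_on_def by blast
  \<comment> \<open>If the score gradient is \<kappa> times \<open>grad a\<close>, the score is
    \<kappa> times \<open>a\<close> plus a constant; two points at which \<open>a\<close> differs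
    cancel the constant. This explicit quotient inherits continuity in \<theta> from the pointwise
    continuity of \<Phi>.\<close>
  define \<kappa> where "\<kappa> \<theta> = (\<Phi> \<theta> x1 - \<Phi> \<theta> x0) / (a x1 - a x0)" for \<theta>
  have \<kappa>: "\<kappa> \<theta> \<noteq> 0" "grad (\<Phi> \<theta>) x = \<kappa> \<theta> *\<^sub>R grad a x" if \<theta>: "\<theta> \<in> \<Theta>" for \<theta> x
  proof -
    note \<Phi> = regular_modelD[OF m \<theta>]
    obtain \<mu> where \<mu>: "\<And>x. grad a x = \<mu> *\<^sub>R grad (\<Phi> \<theta>) x"
      using grads[OF \<theta>] by blast
    have "GDERIV (\<lambda>x. a x - \<mu> * \<Phi> \<theta> x) x :> grad a x - \<mu> *\<^sub>R grad (\<Phi> \<theta>) x" for x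
      using ga[of x] gderiv_grad[OF \<Phi>(2)[of x]]
      unfolding gderiv_def inner_diff_right inner_scaleR_right
      by (intro has_derivative_diff has_derivative_mult_right)
    then have "a x1 - \<mu> * \<Phi> \<theta> x1 = a x0 - \<mu> * \<Phi> \<theta> x0"
      using \<mu> by (intro grad_zero_imp_constant) simp
    then have "\<mu> * (\<Phi> \<theta> x1 - \<Phi> \<theta> x0) = a x1 - a x0"
      by (simp add: algebra_simps)
    \<comment> \<open>This identity gives both that \<kappa> never vanishes and that the
      proportionality can be inverted.\<close>
    then have "\<mu> * \<kappa> \<theta> = 1"
      using x01 by (simp add: \<kappa>_def)
    then show "\<kappa> \<theta> \<noteq> 0" "grad (\<Phi> \<theta>) x = \<kappa> \<theta> *\<^sub>R grad a x"
      by (auto simp: \<mu> mult.commute)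
  qed
  have \<kappa>_cont: "continuous_on \<Theta> \<kappa>"
    using m x01 unfolding regular_model_def \<kappa>_def by (intro continuous_intros) auto
  \<comment> \<open>In the parameter \<open>h \<theta>\<close> the derivative of the density is
    divided by \<kappa>, so the gradient in the continuity equation becomes \<open>grad a\<close>,
    which is the same for all parameters.\<close>
  obtain h where h: "\<And>\<theta>. \<theta> \<in> \<Theta> \<Longrightarrow> (h has_real_derivative \<kappa> \<theta>) (at \<theta>)"
    using antiderivative_on_open_interval[OF \<Theta>(1,2) \<kappa>_cont] by blast
  have mono: "strict_mono_on \<Theta> h \<or> strict_antimono_on \<Theta> h"
    using strict_mono_on_of_deriv_nonzero[OF \<Theta>(2) h \<kappa>_cont \<kappa>(1)] .
  have h_cont: "continuous_on \<Theta> h"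
    using h DERIV_isCont by (intro continuous_at_imp_continuous_on) blast
  define k where "k = inv_into \<Theta> h"
  define q where "q = reparametrize \<Theta> h p"
  \<comment> \<open>The candidate score is \<open>a\<close> centred at its mean, as the
    normalization demands.\<close>
  define \<Psi> where "\<Psi> t x = a x - expect p (k t) a" for t x
  note inj = continuous_on_inv_into_strict_mono_on[OF \<Theta>(1) mono]
  have J: "open (h ` \<Theta>)" "is_interval (h ` \<Theta>)" "h ` \<Theta> \<noteq> {}"
    using invariance_of_domain[OF h_cont \<Theta>(1) inj(1)] \<Theta> h_cont
    by (auto simp: is_interval_connected_1 connected_continuous_image)
  have kJ: "k t \<in> \<Theta>" if "t \<in> h ` \<Theta>" for t
    using that by (simp add: k_def inv_into_into)
  have qp: "q t = p (k t)" for t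
    by (simp add: q_def k_def reparametrize_def)
  have law: "law q t = law p (k t)" "expect q t f = expect p (k t) f" for t f
    by (simp_all add: law_def expect_def qp)
  have k': "(k has_real_derivative 1 / \<kappa> (k t)) (at t)" if t: "t \<in> h ` \<Theta>" for t
  proof (rule has_real_derivative_inner_function[where f = h])
    show "(h has_real_derivative \<kappa> (k t)) (at (k t))" "\<kappa> (k t) \<noteq> 0"
      using h \<kappa>(1) kJ[OF t] by auto
    show "((\<lambda>s. h (k s)) has_real_derivative 1) (at t)"
      by (rule has_field_derivative_transform_within_open[OF DERIV_ident J(1) t])
        (simp add: k_def f_inv_into_f)
    show "isCont k t"
      using inj(2) J(1) t continuous_on_eq_continuous_at unfolding k_def by blast
  qed
  have dq: "((\<lambda>t. q t x) has_real_derivative deriv (\<lambda>s. p s x) (k t) * (1 / \<kappa> (k t))) (at t)"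
    if "t \<in> h ` \<Theta>" for t x
    unfolding qp using DERIV_chain2[OF density_modelD(5)[OF dm kJ[OF that]] k'[OF that]] .
  have "density_model (h ` \<Theta>) q"
    unfolding density_model_def law qp
  proof (intro conjI ballI allI J)
    fix t assume t: "t \<in> h ` \<Theta>"
    show "0 < p (k t) x" "C1 (p (k t))" "prob_space (law p (k t))" for x
      using density_modelD[OF dm kJ[OF t]] by auto
  next
    show "(\<lambda>t. p (k t) x) differentiable_on h ` \<Theta>" for x
      using dq[of _ x] unfolding qp differentiable_on_def
      by (meson differentiable_at_withinI real_differentiable_def)
  qed
  have grad_\<Psi>: "grad (\<Psi> t) = grad a" for t
  proof
    fix x
    show "grad (\<Psi> t) x = grad a x"
      using GDERIV_diff[OF ga[of x] GDERIV_const[of "expect p (k t) a" x]]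
      unfolding \<Psi>_def by (intro grad_eqI) simp
  qed
  \<comment> \<open>The estimator is only assumed \<open>C1\<close>; its second-order regularity
    comes from the score. The zero summand casts a scalar multiple as a linear combination.\<close>
  have C1_grad_a: "C1 (grad a)" if "\<theta> \<in> \<Theta>" for \<theta>
  proof -
    have "grad a = (\<lambda>x. inverse (\<kappa> \<theta>) *\<^sub>R grad (\<Phi> \<theta>) x + 0 *\<^sub>R grad (\<Phi> \<theta>) x)"
      using \<kappa>[OF that] by (simp add: fun_eq_iff)
    then show ?thesis
      using C1_lincomb[OF regular_modelD(3)[OF m that] regular_modelD(3)[OF m that], of "inverse (\<kappa> \<theta>)" 0] by simp
  qed
  have "regular_model (h ` \<Theta>) q \<Psi>"
    unfolding regular_model_def wasserstein_score_def wasserstein_information_def grad_\<Psi> law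
  proof (intro conjI ballI allI)
    show "density_model (h ` \<Theta>) q" by fact
    fix t assume t: "t \<in> h ` \<Theta>"
    note \<Phi> = regular_modelD[OF m kJ[OF t]]
    note p = density_modelD[OF dm kJ[OF t]]
    note ea = regular_estimatorD[OF dm e kJ[OF t]]
    have fin: "finite_measure (law p (k t))"
      using p(4) by (simp add: prob_space.finite_measure)
    show "\<Psi> t differentiable at x" for x
      using GDERIV_diff[OF ga[of x] GDERIV_const[of "expect p (k t) a" x]]
      unfolding \<Psi>_def gderiv_def differentiable_def by blast
    show "C1 (grad a)"
      using C1_grad_a[OF kJ[OF t]] .
    show "deriv (\<lambda>t. q t x) t + divergence (\<lambda>y. q t y *\<^sub>R grad a y) x = 0" for x
    proof -
      have d: "(\<lambda>y. p (k t) y *\<^sub>R grad a y) differentiable at x"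
        using C1_scaleR[OF p(1) \<open>C1 (grad a)\<close>] by (simp add: C1_def)
      have "(\<lambda>y. p (k t) y *\<^sub>R grad (\<Phi> (k t)) y)
          = (\<lambda>y. \<kappa> (k t) *\<^sub>R (p (k t) y *\<^sub>R grad a y) + 0 *\<^sub>R (p (k t) y *\<^sub>R grad a y))"
        using \<kappa>(2)[OF kJ[OF t]] by (simp add: fun_eq_iff mult.commute)
      then have "deriv (\<lambda>s. p s x) (k t) = - \<kappa> (k t) * divergence (\<lambda>y. p (k t) y *\<^sub>R grad a y) x"
        using divergence_lincomb[OF d d, of "\<kappa> (k t)" 0] \<Phi>(5)[of x] by simp
      then show ?thesis
        using DERIV_imp_deriv[OF dq[OF t, of x]] \<kappa>(1)[OF kJ[OF t]] by (simp add: qp)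
    qed
    show "integrable (law p (k t)) (\<Psi> t)"
      unfolding \<Psi>_def using ea(2) finite_measure.integrable_const[OF fin]
      by (rule Bochner_Integration.integrable_diff)
    show "expect p (k t) (\<Psi> t) = 0"
      using Bochner_Integration.integral_diff[OF ea(2) finite_measure.integrable_const[OF fin]]
      by (simp add: \<Psi>_def[abs_def] expect_def prob_space.prob_space[OF p(4)])
    show "integrable (law p (k t)) (\<lambda>x. (norm (grad a x))\<^sup>2)"
      using e kJ[OF t] by (simp add: regular_estimator_def)
    \<comment> \<open>The old and new information differ by the square of \<kappa>, so positivity
      carries over to the new parameter.\<close>
    have "wasserstein_information p \<Phi> (k t) = (\<kappa> (k t))\<^sup>2 * expect p (k t) (\<lambda>x. (norm (grad a x))\<^sup>2)"
      unfolding wasserstein_information_def \<kappa>(2)[OF kJ[OF t]] expect_def by (simp add: power_mult_distrib)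
    then show "0 < expect p (k t) (\<lambda>x. (norm (grad a x))\<^sup>2)"
      using \<Phi>(10) by (simp add: zero_less_mult_iff)
  next
    fix x
    \<comment> \<open>The mean is differentiable and \<open>k\<close> is continuous, which gives the
      continuity of the new score in its parameter.\<close>
    have "continuous_on \<Theta> (\<lambda>\<theta>. expect p \<theta> a)"
      using has_real_derivative_expect[OF m e] DERIV_isCont
      by (intro continuous_at_imp_continuous_on) blast
    then have "continuous_on (h ` \<Theta>) (\<lambda>t. expect p (k t) a)"
      using inj(2)[folded k_def] by (rule continuous_on_compose2) (use kJ in auto)
    then show "continuous_on (h ` \<Theta>) (\<lambda>t. \<Psi> t x)"
      unfolding \<Psi>_def by (intro continuous_intros)
  qed
  then have "e_geodesic (h ` \<Theta>) q \<Psi>"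
    unfolding e_geodesic_def
    by (intro conjI exI[of _ a] exI[of _ "\<lambda>t. expect p (k t) a"]) (simp_all add: \<Psi>_def)
  moreover have "affine_in_score (h ` \<Theta>) \<Psi> a"
    unfolding affine_in_score_def
    by (intro exI[of _ 1] exI[of _ "\<lambda>t. expect p (k t) a"]) (simp add: \<Psi>_def)
  ultimately show ?thesis
    using mono unfolding q_def by blast
qed

theorem corollary1:
  fixes \<Theta> :: "real set"
    and p \<Phi> :: "real \<Rightarrow> 'a::euclidean_space \<Rightarrow> real"
    and a :: "'a \<Rightarrow> real"
  assumes "regular_model \<Theta> p \<Phi>"
    and "regular_estimator \<Theta> p a"
    and "\<not> a constant_on UNIV"
  shows "attains_WCR_bound \<Theta> p \<Phi> a \<longleftrightarrow>
    (\<exists>h \<Psi>. (strict_mono_on \<Theta> h \<or> strict_antimono_on \<Theta> h) \<and>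
       e_geodesic (h ` \<Theta>) (reparametrize \<Theta> h p) \<Psi> \<and>
       affine_in_score (h ` \<Theta>) \<Psi> a)"
    (is "_ \<longleftrightarrow> ?geodesic")
proof -
  \<comment> \<open>Both sides are compared with proportionality of gradients, where the factor may
    vary with \<theta>; removing that dependence is the task of the reparametrization.\<close>
  have "attains_WCR_bound \<Theta> p \<Phi> a \<longleftrightarrow>
      (\<forall>\<theta>\<in>\<Theta>. \<exists>\<mu>. \<forall>x. grad a x = \<mu> *\<^sub>R grad (\<Phi> \<theta>) x)"
    unfolding attains_WCR_bound_def
    using WCR_equality_iff_proportional_gradients[OF assms(1,2)] by blast
  also have "\<dots> \<longleftrightarrow> ?geodesic"
  proof
    assume "\<forall>\<theta>\<in>\<Theta>. \<exists>\<mu>. \<forall>x. grad a x = \<mu> *\<^sub>R grad (\<Phi> \<theta>) x"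
    then show ?geodesic
      using proportional_gradients_imp_e_geodesic[OF assms] by blast
  next
    assume ?geodesic
    then show "\<forall>\<theta>\<in>\<Theta>. \<exists>\<mu>. \<forall>x. grad a x = \<mu> *\<^sub>R grad (\<Phi> \<theta>) x"
      using e_geodesic_imp_proportional_gradients[OF assms(1)] unfolding e_geodesic_def by blast
  qed
  finally show ?thesis .
qed

end
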